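(* Let $r\ge 5$ be a prime and $A=ie^{2\pi i/4r}$. The projective representation $\rho_{\mathrm{SO}(3)}$ of $\mathrm{SL}_2(\mathbb{Z})$ (the mapping class group $M_1$ of the torus $S^1\times S^1$) given by the $\mathrm{SO}(3)$-theory at $A$ is equivalent, as a projective representation, to the one obtained by composing the (mod $r$) reduction map $\mathrm{SL}_2(\mathbb{Z})\to \mathrm{SL}_2(\mathbb{F}_r)$ with the odd factor of the Weil representation of $\mathrm{SL}_2(\mathbb{F}_r)$.
   Context: **The $\mathrm{SO}(3)$-theory in genus 1.** Let $r\ge5$ be prime and $A=ie^{2\pi i/4r}=e^{2\pi i(r+1)/4r}$. Put $[k]=\frac{A^{2k}-A^{-2k}}{A^2-A^{-2}}$, let the label set be $L=\{0,2,4,\ldots,r-3\}$, and let $D=\sqrt{\sum_{i\in L}[i+1]^2}=\frac{\sqrt r}{2\sin(\pi/r)}$. Let $s=\begin{pmatrix}0&-1\\1&0\end{pmatrix}$, $t=\begin{pmatrix}1&1\\0&1\end{pmatrix}$ be the standard generators of $\mathrm{SL}_2(\mathbb{Z})$. The $\mathrm{SO}(3)$-theory projective representation of $M_1=\mathrm{SL}_2(\mathbb{Z})$ is the homomorphism $\rho_{\mathrm{SO}(3)}:\mathrm{SL}_2(\mathbb{Z})\to \mathrm{PGL}_{(r-1)/2}(\mathbb{C})$ determined by $$\rho_{\mathrm{SO}(3)}(s)=\frac1D\bigl([(i+1)(j+1)]\bigr)_{i,j\in L},\qquad \rho_{\mathrm{SO}(3)}(t)=\bigl(A^{-j(j+2)}\delta_{ij}\bigr)_{i,j\in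 L}$$ (matrices taken modulo scalars). **The Weil representation.** Let $H_r$ be the Heisenberg group of order $r^3$ (of exponent $r$), a central extension $0\to\mathbb{F}_r\to H_r\to\mathbb{F}_r^2\to0$ whose commutator pairing induces a symplectic form on $\mathbb{F}_r^2$. Let $x,y\in H_r$ be elements whose images in $\mathbb{F}_r^2$ form a unimodular basis and let $z$ be the generator of the center with $z^2=yxy^{-1}x^{-1}$. The group $\mathrm{SL}_2(\mathbb{F}_r)$ acts on $H_r$ by automorphisms: $M=\begin{pmatrix}a&b\\c&d\end{pmatrix}$ acts by $f_M(x)=z^{ac}x^ay^c$, $f_M(y)=z^{bd}x^by^d$, $f_M(z)=z$. Write $e(k)=e^{2\pi ik/r}$. Let $(\rho,V)$ be the Stone–von Neumann representation, i.e. the unique irreducible complex representation of $H_r$ with central character $z^k\mapsto e(k)$. Explicitly, $V$ has a basis $e_0,\ldots,e_{r-1}$ (indices mod $r$) with $\rho(x)e_k=e(2k)e_k$, $\rho(y)e_k=e_{k-1}$, $\rho(z)=e(1)\,\mathrm{Id}$. For each $\alpha\in \mathrm{SL}_2(\mathbb{F}_r)\subset\mathrm{Aut}(H_r)$ there is $R_\alpha\in\mathrm{GL}(V)$, unique up to scalar, with $R_\alpha\rho(h)R_\alpha^{-1}=\rho(\alpha(h))$ for all $h\in H_r$. Then $\alpha\mapsto R_\alpha$ is a projective representation of $\mathrm{SL}_2(\mathbb{F}_r)$, which lifts uniquely to an $r$-dimensional linear representation, the Weil representation. Its odd factor is the $\frac{r-1}{2}$-dimensional invariant subspace $V^{\mathrm{odd}}$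 spanned by the vectors $e_k-e_{-k}$, $k\in\mathbb{Z}/r$. *)

theory Defs
  imports
    Complex_Main
    "HOL-Algebra.Coset"
    "HOL-Algebra.IntRing"
    "HOL-Number_Theory.Residues"
    "Jordan_Normal_Form.VS_Connect"
begin

section \<open>Linear and projective linear groups\<close>

abbreviation GL :: "nat \<Rightarrow> complex mat monoid" where
  "GL n \<equiv> units_of (ring_mat TYPE(complex) n ())"

definition scalar_mats :: "nat \<Rightarrow> complex mat set" where
  "scalar_mats n = {c \<cdot>\<^sub>m 1\<^sub>m n | c. c \<noteq> 0}"

definition PGL :: "nat \<Rightarrow> complex mat set monoid" where
  "PGL n = GL n Mod scalar_mats n"

definition proj_class :: "nat \<Rightarrow> complex mat \<Rightarrow> complex mat set" where
  "proj_class n M = scalar_mats n #>\<^bsub>GL n\<^esub> M"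

definition proj_rep_equiv ::
  "('g, 'm) monoid_scheme \<Rightarrow> nat \<Rightarrow> ('g \<Rightarrow> complex mat set) \<Rightarrow> ('g \<Rightarrow> complex mat set) \<Rightarrow> bool" where
  "proj_rep_equiv G n \<phi> \<psi> \<longleftrightarrow>
     \<phi> \<in> hom G (PGL n) \<and> \<psi> \<in> hom G (PGL n) \<and>
     (\<exists>P \<in> carrier (PGL n). \<forall>g \<in> carrier G.
        P \<otimes>\<^bsub>PGL n\<^esub> \<phi> g \<otimes>\<^bsub>PGL n\<^esub> inv\<^bsub>PGL n\<^esub> P = \<psi> g)"

text \<open>The tuple \<open>(a, b, c, d)\<close> stands for the matrix with rows \<open>(a, b)\<close> and \<open>(c, d)\<close>.\<close>

definition SL2 :: "('a, 'm) ring_scheme \<Rightarrow> ('a \<times> 'a \<times> 'a \<times> 'a) monoid" where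
  "SL2 R = \<lparr>carrier = {(a, b, c, d). a \<in> carrier R \<and> b \<in> carrier R \<and> c \<in> carrier R \<and> d \<in> carrier R \<and>
                        a \<otimes>\<^bsub>R\<^esub> d \<ominus>\<^bsub>R\<^esub> b \<otimes>\<^bsub>R\<^esub> c = \<one>\<^bsub>R\<^esub>},
            monoid.mult = (\<lambda>(a, b, c, d) (a', b', c', d').
                     (a \<otimes>\<^bsub>R\<^esub> a' \<oplus>\<^bsub>R\<^esub> b \<otimes>\<^bsub>R\<^esub> c', a \<otimes>\<^bsub>R\<^esub> b' \<oplus>\<^bsub>R\<^esub> b \<otimes>\<^bsub>R\<^esub> d',
                      c \<otimes>\<^bsub>R\<^esub> a' \<oplus>\<^bsub>R\<^esub> d \<otimes>\<^bsub>R\<^esub> c', c \<otimes>\<^bsub>R\<^esub> b' \<oplus>\<^bsub>R\<^esub> d \<otimes>\<^bsub>R\<^esub> d')),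
            one = (\<one>\<^bsub>R\<^esub>, \<zero>\<^bsub>R\<^esub>, \<zero>\<^bsub>R\<^esub>, \<one>\<^bsub>R\<^esub>)\<rparr>"

abbreviation SL2Z :: "(int \<times> int \<times> int \<times> int) monoid" where
  "SL2Z \<equiv> SL2 int_ring"

abbreviation SL2F :: "nat \<Rightarrow> (int \<times> int \<times> int \<times> int) monoid" where
  "SL2F r \<equiv> SL2 (residue_ring (int r))"

definition SL2_reduce :: "nat \<Rightarrow> int \<times> int \<times> int \<times> int \<Rightarrow> int \<times> int \<times> int \<times> int" where
  "SL2_reduce r = (\<lambda>(a, b, c, d). (a mod int r, b mod int r, c mod int r, d mod int r))"

definition SL2_s :: "int \<times> int \<times> int \<times> int" where "SL2_s = (0, -1, 1, 0)"
definition SL2_t :: "int \<times> int \<times> int \<times> int" where "SL2_t = (1, 1, 0, 1)"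


section \<open>The SO(3)-theory in genus 1\<close>

definition so3_A :: "nat \<Rightarrow> complex" where
  "so3_A r = \<i> * exp (2 * of_real pi * \<i> / (4 * of_nat r))"

definition qint :: "nat \<Rightarrow> nat \<Rightarrow> complex" where
  "qint r k = (so3_A r powi (2 * int k) - so3_A r powi (- 2 * int k)) /
              (so3_A r powi 2 - so3_A r powi (- 2))"

definition so3_labels :: "nat \<Rightarrow> nat set" where
  "so3_labels r = {i. even i \<and> i \<le> r - 3}"

text \<open>The sum under the root is a positive real number, so \<open>csqrt\<close> is its positive square root.\<close>

definition so3_D :: "nat \<Rightarrow> complex" where
  "so3_D r = csqrt (\<Sum>i \<in> so3_labels r. (qint r (i + 1))\<^sup>2)"

text \<open>Row and column number \<open>a < (r - 1) div 2\<close> of the following matrices carries the label \<open>2 * a\<close>.\<close>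

definition so3_S :: "nat \<Rightarrow> complex mat" where
  "so3_S r = mat ((r - 1) div 2) ((r - 1) div 2)
     (\<lambda>(a, b). let i = 2 * a; j = 2 * b in 1 / so3_D r * qint r ((i + 1) * (j + 1)))"

definition so3_T :: "nat \<Rightarrow> complex mat" where
  "so3_T r = mat ((r - 1) div 2) ((r - 1) div 2)
     (\<lambda>(a, b). let j = 2 * b in if a = b then so3_A r powi (- int (j * (j + 2))) else 0)"

text \<open>Here and for \<open>weil_rep\<close> below, \<open>extensional\<close> only fixes the values off the carrier, so that
  the described homomorphism is unique as a HOL function.\<close>

definition so3_rep :: "nat \<Rightarrow> int \<times> int \<times> int \<times> int \<Rightarrow> complex mat set" where
  "so3_rep r = (THE \<phi>. \<phi> \<in> hom SL2Z (PGL ((r - 1) div 2)) \<inter> extensional (carrier SL2Z) \<and>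
     \<phi> SL2_s = proj_class ((r - 1) div 2) (so3_S r) \<and>
     \<phi> SL2_t = proj_class ((r - 1) div 2) (so3_T r))"


section \<open>The Heisenberg group and its Stone--von Neumann representation\<close>

text \<open>The triple \<open>(k, m, n)\<close> of residues stands for the normal form \<open>z\<^sup>k x\<^sup>m y\<^sup>n\<close>. The product comes
  from moving \<open>y\<^sup>n\<close> past \<open>x\<^sup>p\<close> by means of \<open>y x = z\<^sup>2 x y\<close>.\<close>

definition Heis :: "nat \<Rightarrow> (int \<times> int \<times> int) monoid" where
  "Heis r = \<lparr>carrier = {0..<int r} \<times> {0..<int r} \<times> {0..<int r},
             monoid.mult = (\<lambda>(k, m, n) (k', m', n').
                      ((k + k' + 2 * n * m') mod int r, (m + m') mod int r, (n + n') mod int r)),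
             one = (0, 0, 0)\<rparr>"

definition heis_x :: "int \<times> int \<times> int" where "heis_x = (0, 1, 0)"
definition heis_y :: "int \<times> int \<times> int" where "heis_y = (0, 0, 1)"
definition heis_z :: "int \<times> int \<times> int" where "heis_z = (1, 0, 0)"

lemma Heis_assoc_aux:
  fixes m :: int
  shows "(u mod m + v + 2 * (w mod m) * q) mod m = (u + v + 2 * w * q) mod m"
    and "(v + u mod m + 2 * q * (w mod m)) mod m = (v + u + 2 * q * w) mod m"
  by (fold cong_def; intro cong_add cong_mult cong_refl; simp add: cong_def)+

lemma Heis_group:
  assumes "r > 0"
  shows "group (Heis r)"
proof (rule groupI)
  fix u v w assume "u \<in> carrier (Heis r)" "v \<in> carrier (Heis r)" "w \<in> carrier (Heis r)"
  obtain a b c where u: "u = (a, b, c)" by (cases u)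
  obtain a' b' c' where v: "v = (a', b', c')" by (cases v)
  obtain a'' b'' c'' where w: "w = (a'', b'', c'')" by (cases w)
  show "u \<otimes>\<^bsub>Heis r\<^esub> v \<otimes>\<^bsub>Heis r\<^esub> w = u \<otimes>\<^bsub>Heis r\<^esub> (v \<otimes>\<^bsub>Heis r\<^esub> w)"
    by (simp add: u v w Heis_def Heis_assoc_aux) (simp add: mod_simps algebra_simps)
next
  fix u assume u: "u \<in> carrier (Heis r)"
  obtain a b c where u': "u = (a, b, c)" by (cases u)
  show "\<exists>v\<in>carrier (Heis r). v \<otimes>\<^bsub>Heis r\<^esub> u = \<one>\<^bsub>Heis r\<^esub>"
    using assms u
    by (intro bexI[of _ "((2 * c * b - a) mod int r, (- b) mod int r, (- c) mod int r)"])
       (auto simp: u' Heis_def mod_simps Heis_assoc_aux(1)[where v = a])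
qed (use assms in \<open>auto simp: Heis_def\<close>)

lemma Heis_commutator:
  assumes "r \<ge> 3"
  shows "heis_y \<otimes>\<^bsub>Heis r\<^esub> heis_x = heis_z [^]\<^bsub>Heis r\<^esub> (2 :: nat) \<otimes>\<^bsub>Heis r\<^esub> heis_x \<otimes>\<^bsub>Heis r\<^esub> heis_y"
  using assms by (simp add: Heis_def heis_x_def heis_y_def heis_z_def numeral_2_eq_2)

lemma Heis_normal_form:
  assumes "(k, m, n) \<in> carrier (Heis r)"
  shows "heis_z [^]\<^bsub>Heis r\<^esub> k \<otimes>\<^bsub>Heis r\<^esub> heis_x [^]\<^bsub>Heis r\<^esub> m \<otimes>\<^bsub>Heis r\<^esub> heis_y [^]\<^bsub>Heis r\<^esub> n = (k, m, n)"
proof -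
  have bounds: "0 \<le> k" "k < int r" "0 \<le> m" "m < int r" "0 \<le> n" "n < int r"
    using assms by (auto simp: Heis_def)
  have "heis_z [^]\<^bsub>Heis r\<^esub> j = (int j mod int r, 0, 0)"
    "heis_x [^]\<^bsub>Heis r\<^esub> j = (0, int j mod int r, 0)"
    "heis_y [^]\<^bsub>Heis r\<^esub> j = (0, 0, int j mod int r)" for j :: nat
    by (induction j) (simp_all add: Heis_def heis_x_def heis_y_def heis_z_def mod_simps algebra_simps)
  then show ?thesis
    using bounds by (simp add: int_pow_def2) (simp add: Heis_def)
qed

text \<open>The automorphism \<open>f\<^sub>M\<close> is given on generators and extended along \<open>z\<^sup>k x\<^sup>m y\<^sup>n\<close>.\<close>

definition heis_act :: "nat \<Rightarrow> int \<times> int \<times> int \<times> int \<Rightarrow> int \<times> int \<times> int \<Rightarrow> int \<times> int \<times> int" where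
  "heis_act r = (\<lambda>(a, b, c, d) (k, m, n).
     let fx = heis_z [^]\<^bsub>Heis r\<^esub> (a * c) \<otimes>\<^bsub>Heis r\<^esub> heis_x [^]\<^bsub>Heis r\<^esub> a \<otimes>\<^bsub>Heis r\<^esub> heis_y [^]\<^bsub>Heis r\<^esub> c;
         fy = heis_z [^]\<^bsub>Heis r\<^esub> (b * d) \<otimes>\<^bsub>Heis r\<^esub> heis_x [^]\<^bsub>Heis r\<^esub> b \<otimes>\<^bsub>Heis r\<^esub> heis_y [^]\<^bsub>Heis r\<^esub> d
     in heis_z [^]\<^bsub>Heis r\<^esub> k \<otimes>\<^bsub>Heis r\<^esub> fx [^]\<^bsub>Heis r\<^esub> m \<otimes>\<^bsub>Heis r\<^esub> fy [^]\<^bsub>Heis r\<^esub> n)"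

definition root_e :: "nat \<Rightarrow> int \<Rightarrow> complex" where
  "root_e r k = exp (2 * of_real pi * \<i> * of_int k / of_nat r)"

definition svn_X :: "nat \<Rightarrow> complex mat" where
  "svn_X r = mat r r (\<lambda>(i, j). if i = j then root_e r (2 * int j) else 0)"

text \<open>Column \<open>j\<close> of \<open>svn_Y r\<close> is the basis vector with index \<open>j - 1\<close> modulo \<open>r\<close>.\<close>

definition svn_Y :: "nat \<Rightarrow> complex mat" where
  "svn_Y r = mat r r (\<lambda>(i, j). if int i = (int j - 1) mod int r then 1 else 0)"

definition svn_rep :: "nat \<Rightarrow> int \<times> int \<times> int \<Rightarrow> complex mat" where
  "svn_rep r = (\<lambda>(k, m, n). root_e r k \<cdot>\<^sub>m (svn_X r ^\<^sub>m nat m * svn_Y r ^\<^sub>m nat n))"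


section \<open>The Weil representation and its odd factor\<close>

definition weil_intertwiner :: "nat \<Rightarrow> int \<times> int \<times> int \<times> int \<Rightarrow> complex mat \<Rightarrow> bool" where
  "weil_intertwiner r \<alpha> R \<longleftrightarrow> R \<in> carrier (GL r) \<and>
     (\<forall>h \<in> carrier (Heis r).
        R \<otimes>\<^bsub>GL r\<^esub> svn_rep r h \<otimes>\<^bsub>GL r\<^esub> inv\<^bsub>GL r\<^esub> R = svn_rep r (heis_act r \<alpha> h))"

definition weil_rep :: "nat \<Rightarrow> int \<times> int \<times> int \<times> int \<Rightarrow> complex mat" where
  "weil_rep r = (THE W. W \<in> hom (SL2F r) (GL r) \<inter> extensional (carrier (SL2F r)) \<and>
     (\<forall>\<alpha> \<in> carrier (SL2F r). weil_intertwiner r \<alpha> (W \<alpha>)))"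

definition odd_vec :: "nat \<Rightarrow> int \<Rightarrow> complex vec" where
  "odd_vec r k = unit_vec r (nat (k mod int r)) - unit_vec r (nat ((- k) mod int r))"

definition V_odd :: "nat \<Rightarrow> complex vec set" where
  "V_odd r = LinearCombinations.module.span class_ring (module_vec TYPE(complex) r) (range (odd_vec r))"

definition odd_basis :: "nat \<Rightarrow> complex vec list" where
  "odd_basis r = map (\<lambda>k. odd_vec r (int k)) [1..<(r - 1) div 2 + 1]"

lemma odd_basis_of_V_odd:
  assumes "odd r"
  shows "distinct (odd_basis r)"
    and "LinearCombinations.module.lin_indpt class_ring (module_vec TYPE(complex) r) (set (odd_basis r))"
    and "LinearCombinations.module.span class_ring (module_vec TYPE(complex) r) (set (odd_basis r)) = V_odd r"
proof -
  interpret vec_space "TYPE(complex)" r .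
  define n where "n = (r - 1) div 2"
  have r: "r = 2 * n + 1" using assms by (auto simp: n_def elim: oddE)
  have set: "set (odd_basis r) = (\<lambda>k. odd_vec r (int k)) ` {1..n}"
    by (auto simp: odd_basis_def n_def)
  have ov: "odd_vec r (int k) = unit_vec r k - unit_vec r (r - k)" if "1 \<le> k" "k \<le> n" for k
  proof -
    have "(- int k) mod int r = int r - int k"
      using that r by (simp add: zmod_zminus1_eq_if)
    moreover have "int k mod int r = int k" using that r by simp
    moreover have "nat (int r - int k) = r - k" by simp
    ultimately show ?thesis unfolding odd_vec_def by (simp only: nat_int)
  qed
  have comp: "odd_vec r (int j) $ k = (if j = k then 1 else 0)"
    if "1 \<le> j" "j \<le> n" "1 \<le> k" "k \<le> n" for j k
    using that r ov[of j] by auto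
  have inj: "inj_on (\<lambda>k. odd_vec r (int k)) {1..n}"
    by (rule inj_onI) (metis atLeastAtMost_iff comp zero_neq_one)
  show "distinct (odd_basis r)"
  proof -
    have "set [1..<n + 1] = {1..n}" by auto
    then show ?thesis
      using inj unfolding odd_basis_def n_def[symmetric] distinct_map by simp
  qed
  have carr: "odd_vec r k \<in> carrier_vec r" for k by (simp add: odd_vec_def)
  have sub: "set (odd_basis r) \<subseteq> carrier_vec r" using carr by (auto simp: set)
  show "lin_indpt (set (odd_basis r))"
  proof (rule finite_lin_indpt2)
    fix a assume a: "lincomb a (set (odd_basis r)) = 0\<^sub>v r"
    show "\<forall>v\<in>set (odd_basis r). a v = 0"
    proof
      fix v assume "v \<in> set (odd_basis r)"
      then obtain k where k: "1 \<le> k" "k \<le> n" "v = odd_vec r (int k)" by (auto simp: set)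
      have "0 = lincomb a (set (odd_basis r)) $ k" using a k r by (simp add: module_vec_simps)
      also have "\<dots> = (\<Sum>w\<in>set (odd_basis r). a w * w $ k)"
        using k r sub by (intro lincomb_index) auto
      also have "\<dots> = (\<Sum>j\<in>{1..n}. a (odd_vec r (int j)) * odd_vec r (int j) $ k)"
        unfolding set by (rule sum.reindex_cong[OF inj]) auto
      also have "\<dots> = (\<Sum>j\<in>{1..n}. if j = k then a v else 0)"
        using k by (intro sum.cong) (auto simp: comp)
      also have "\<dots> = a v" using k by simp
      finally show "a v = 0" by (simp add: class_ring_simps)
    qed
  qed (use sub in \<open>auto simp: module_vec_simps\<close>)
  have in_span: "odd_vec r k \<in> span (set (odd_basis r))" for k
  proof -
    define m where "m = nat (k mod int r)"
    have m: "m < r" "k mod int r = int m" using r by (auto simp: m_def nat_less_iff)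
    have km: "odd_vec r k = odd_vec r (int m)"
      unfolding odd_vec_def m(2)[symmetric] by (simp add: mod_simps)
    consider "m = 0" | "1 \<le> m" "m \<le> n" | "1 \<le> r - m" "r - m \<le> n" "m > 0" using m r by linarith
    then show ?thesis
    proof cases
      case 1
      then have "odd_vec r k = 0\<^sub>v r" unfolding km by (simp add: odd_vec_def r)
      then show ?thesis using span_zero[of "set (odd_basis r)"] by (simp add: module_vec_simps)
    next
      case 2
      then show ?thesis unfolding km using sub by (intro span_mem) (auto simp: set module_vec_simps)
    next
      case 3
      have e: "odd_vec r (int (r - m)) = odd_vec r (- int m)"
        using 3 unfolding odd_vec_def by (simp add: of_nat_diff mod_simps)
      have "odd_vec r (int (r - m)) \<in> span (set (odd_basis r))"
      proof (rule span_mem)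
        have "r - m \<in> {1..n}" using 3 by auto
        then show "odd_vec r (int (r - m)) \<in> set (odd_basis r)" unfolding set by (rule imageI)
      qed (use sub in \<open>auto simp: module_vec_simps\<close>)
      then have "(- 1) \<cdot>\<^sub>v odd_vec r (int (r - m)) \<in> span (set (odd_basis r))"
        using sub by (intro smult_in_span) (auto simp: module_vec_simps)
      moreover have "(- 1) \<cdot>\<^sub>v odd_vec r (int (r - m)) = odd_vec r (int m)"
        unfolding e by (intro eq_vecI) (auto simp: odd_vec_def)
      ultimately show ?thesis by (simp add: km)
    qed
  qed
  show "span (set (odd_basis r)) = V_odd r"
  proof
    show "span (set (odd_basis r)) \<subseteq> V_odd r"
      unfolding V_odd_def by (intro span_is_monotone) (auto simp: set)
    have "range (odd_vec r) \<subseteq> span (set (odd_basis r))" using in_span by auto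
    then show "V_odd r \<subseteq> span (set (odd_basis r))"
      unfolding V_odd_def using span_is_subset sub
      by (metis span_is_monotone span_span)
  qed
qed

text \<open>The matrix, with respect to the basis \<open>bs\<close>, of the restriction of \<open>M\<close> to the \<open>M\<close>-invariant
  subspace of \<open>n\<close>-dimensional space spanned by \<open>bs\<close>.\<close>

definition restriction_mat :: "nat \<Rightarrow> complex vec list \<Rightarrow> complex mat \<Rightarrow> complex mat" where
  "restriction_mat n bs M = (THE N. N \<in> carrier_mat (length bs) (length bs) \<and>
     M * mat_of_cols n bs = mat_of_cols n bs * N)"

definition weil_odd :: "nat \<Rightarrow> int \<times> int \<times> int \<times> int \<Rightarrow> complex mat" where
  "weil_odd r \<alpha> = restriction_mat r (odd_basis r) (weil_rep r \<alpha>)"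

end

theory Submission
  imports
    Defs
    "Jordan_Normal_Form.Determinant"
    "HOL-Library.Real_Mod"
begin

text \<open>Both representations are compared on the generators \<open>s\<close> and \<open>t\<close> of \<open>SL\<^sub>2(\<int>)\<close>. Over these the
  Heisenberg action has the explicit intertwiners \<open>e\<^sub>k \<mapsto> \<Sum>\<^sub>j e(2 j k) e\<^sub>j\<close> and \<open>e\<^sub>k \<mapsto> e(- k\<^sup>2) e\<^sub>k\<close>
  (\<open>weil_intertwiner_S\<close>, \<open>weil_intertwiner_T\<close>). Both commute with \<open>e\<^sub>k \<mapsto> e\<^sub>-\<^sub>k\<close>, and in the basis
  \<open>e\<^sub>k - e\<^sub>-\<^sub>k\<close>, \<open>1 \<le> k \<le> n = (r - 1) / 2\<close>, of the odd vectors they become the matrices with entries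
  \<open>e(2 k l) - e(- 2 k l)\<close> and the diagonal matrix with entries \<open>e(- k\<^sup>2)\<close>. Since \<open>A\<^sup>2 = e(1/2)\<close>, with
  \<open>1/2\<close> read modulo \<open>r\<close>, these are scalar multiples of the matrices of the \<open>SO(3)\<close>-theory when the
  label \<open>i\<close> is matched with \<open>k \<equiv> - (i + 1) / 2\<close>, that is \<open>k = n - i / 2\<close> (\<open>so3_S_eq\<close>, \<open>so3_T_eq\<close>).
  So the order-reversing permutation intertwines the two representations.

  Both representations are given by unique descriptions, and these have to be shown meaningful. For
  the Weil representation, an intertwiner over a given element exists because \<open>s\<close> and \<open>t\<close> generate
  and \<open>SL\<^sub>2(\<int>) \<rightarrow> SL\<^sub>2(\<F>\<^sub>r)\<close> is onto, and it is unique up to a scalar by Schur's lemma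
  (\<open>svn_commutant\<close>). The linear lift comes from the function
  \<open>\<delta>(R) = det R / (det R\<^sup>o\<^sup>d\<^sup>d)\<^sup>2\<close> on intertwiners, where \<open>R\<^sup>o\<^sup>d\<^sup>d\<close> is the restriction to odd vectors: it
  is multiplicative and homogeneous of degree \<open>r - 2 n = 1\<close>, so the condition \<open>\<delta>(R) = 1\<close> selects the
  scalars consistently, without any evaluation of Gauss sums. Every lift satisfies \<open>\<delta> = 1\<close> because
  \<open>SL\<^sub>2(\<F>\<^sub>r)\<close> has no nontrivial character for \<open>r \<ge> 5\<close> (\<open>SL2F_char_trivial\<close>). For the
  \<open>SO(3)\<close>-theory, uniqueness is generation by \<open>s\<close> and \<open>t\<close>, and existence is the comparison above:
  the conjugated odd Weil representation takes the required values.\<close>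


section \<open>Linear groups and the special linear group\<close>

text \<open>All group computations below are carried out with matrices of nonzero determinant.\<close>

lemma carrier_GL: "carrier (GL n) = {M \<in> carrier_mat n n. det M \<noteq> 0}"
proof -
  have "Units (ring_mat TYPE(complex) n ()) = {M \<in> carrier_mat n n. det M \<noteq> 0}"
    using unit_imp_det_non_zero[where n = n and b = "()"]
      det_non_zero_imp_unit[where n = n and b = "()"]
    by (auto simp: Units_def ring_mat_simps)
  then show ?thesis by (simp add: units_of_carrier)
qed

lemma GL_mult [simp]: "M \<otimes>\<^bsub>GL n\<^esub> N = M * N"
  by (simp add: units_of_mult ring_mat_simps)

lemma GL_one [simp]: "\<one>\<^bsub>GL n\<^esub> = 1\<^sub>m n"
  by (simp add: units_of_one ring_mat_simps)

lemma GL_group: "group (GL n)"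
proof -
  interpret ring "ring_mat TYPE(complex) n ()" by (rule ring_mat)
  show ?thesis by (rule units_group)
qed

lemma scalar_mult_mat:
  assumes "M \<in> carrier_mat n m"
  shows "(c \<cdot>\<^sub>m 1\<^sub>m n) * M = c \<cdot>\<^sub>m (M :: complex mat)"
  using assms by (subst mult_smult_assoc_mat[of _ n n]) auto

lemma mult_scalar_mat:
  assumes "M \<in> carrier_mat m n"
  shows "M * (c \<cdot>\<^sub>m 1\<^sub>m n) = c \<cdot>\<^sub>m (M :: complex mat)"
  using assms by (subst mult_smult_distrib[of _ m n]) auto

lemma smult_smult_mat: "c \<cdot>\<^sub>m (d \<cdot>\<^sub>m M) = (c * d) \<cdot>\<^sub>m (M :: complex mat)"
  by (intro eq_matI) auto

lemma scalar_mats_normal: "scalar_mats n \<lhd> GL n"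
proof -
  interpret group "GL n" by (rule GL_group)
  have inv: "inv\<^bsub>GL n\<^esub> (c \<cdot>\<^sub>m 1\<^sub>m n) = inverse c \<cdot>\<^sub>m 1\<^sub>m n" if "c \<noteq> 0" for c :: complex
    by (rule inv_equality) (use that in \<open>auto simp: carrier_GL scalar_mult_mat[where m = n]\<close>)
  have sub: "subgroup (scalar_mats n) (GL n)"
  proof
    show "scalar_mats n \<subseteq> carrier (GL n)" by (auto simp: scalar_mats_def carrier_GL)
    show "\<one>\<^bsub>GL n\<^esub> \<in> scalar_mats n"
      unfolding scalar_mats_def by (auto intro!: exI[of _ "1 :: complex"])
    fix x assume "x \<in> scalar_mats n"
    then obtain c where c: "x = c \<cdot>\<^sub>m 1\<^sub>m n" "c \<noteq> 0" by (auto simp: scalar_mats_def)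
    then show "inv\<^bsub>GL n\<^esub> x \<in> scalar_mats n"
      unfolding c inv[OF c(2)] scalar_mats_def by auto
    fix y assume "y \<in> scalar_mats n"
    then obtain d where d: "y = d \<cdot>\<^sub>m 1\<^sub>m n" "d \<noteq> 0" by (auto simp: scalar_mats_def)
    have "x * y = (c * d) \<cdot>\<^sub>m 1\<^sub>m n" by (simp add: c d scalar_mult_mat[where m = n] smult_smult_mat)
    then show "x \<otimes>\<^bsub>GL n\<^esub> y \<in> scalar_mats n"
      using c d unfolding scalar_mats_def by (auto intro!: exI[of _ "c * d"])
  qed
  show ?thesis
  proof (rule normalI[OF sub], rule ballI)
    fix x assume "x \<in> carrier (GL n)"
    then show "scalar_mats n #>\<^bsub>GL n\<^esub> x = x <#\<^bsub>GL n\<^esub> scalar_mats n"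
      by (auto simp: carrier_GL r_coset_def l_coset_def scalar_mats_def scalar_mult_mat mult_scalar_mat)
  qed
qed

lemma PGL_group: "group (PGL n)"
  unfolding PGL_def by (rule normal.factorgroup_is_group[OF scalar_mats_normal])

lemma proj_class_hom: "proj_class n \<in> hom (GL n) (PGL n)"
  unfolding PGL_def proj_class_def[abs_def] by (rule normal.r_coset_hom_Mod[OF scalar_mats_normal])

lemma proj_class_smult:
  assumes "M \<in> carrier_mat n n" "c \<noteq> 0"
  shows "proj_class n (c \<cdot>\<^sub>m M) = proj_class n M"
proof -
  have "proj_class n M = {d \<cdot>\<^sub>m M | d. d \<noteq> 0}" if "M \<in> carrier_mat n n" for M
    unfolding proj_class_def r_coset_def scalar_mats_def
    by (auto simp: scalar_mult_mat[OF that])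
  moreover have "{d \<cdot>\<^sub>m (c \<cdot>\<^sub>m M) | d. d \<noteq> 0} = {d \<cdot>\<^sub>m M | d. d \<noteq> 0}"
  proof (intro subset_antisym subsetI)
    fix x assume "x \<in> {d \<cdot>\<^sub>m (c \<cdot>\<^sub>m M) | d. d \<noteq> 0}"
    then obtain d where "x = d \<cdot>\<^sub>m (c \<cdot>\<^sub>m M)" "d \<noteq> 0" by blast
    then have "x = (d * c) \<cdot>\<^sub>m M" "d * c \<noteq> 0" using assms by (simp_all add: smult_smult_mat)
    then show "x \<in> {d \<cdot>\<^sub>m M | d. d \<noteq> 0}" by blast
  next
    fix x assume "x \<in> {d \<cdot>\<^sub>m M | d. d \<noteq> 0}"
    then obtain d where "x = d \<cdot>\<^sub>m M" "d \<noteq> 0" by blast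
    then have "x = (d / c) \<cdot>\<^sub>m (c \<cdot>\<^sub>m M)" "d / c \<noteq> 0"
      using assms by (simp_all add: smult_smult_mat)
    then show "x \<in> {d \<cdot>\<^sub>m (c \<cdot>\<^sub>m M) | d. d \<noteq> 0}" by blast
  qed
  ultimately show ?thesis using assms by simp
qed

lemma SL2Z_carrier: "(a, b, c, d) \<in> carrier SL2Z \<longleftrightarrow> a * d - b * c = 1"
  by (simp add: SL2_def int_a_minus_eq)

lemma SL2_mult_int:
  "(a, b, c, d) \<otimes>\<^bsub>SL2Z\<^esub> (a', b', c', d') =
     (a * a' + b * c', a * b' + b * d', c * a' + d * c', c * b' + d * d')"
  by (simp add: SL2_def)

lemma SL2F_carrier:
  assumes "r > 1"
  shows "(a, b, c, d) \<in> carrier (SL2F r) \<longleftrightarrow>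
    a \<in> {0..<int r} \<and> b \<in> {0..<int r} \<and> c \<in> {0..<int r} \<and> d \<in> {0..<int r} \<and>
    [a * d - b * c = 1] (mod int r)"
proof -
  interpret residues "int r" "residue_ring (int r)" using assms by unfold_locales auto
  have "a * d mod int r \<ominus>\<^bsub>residue_ring (int r)\<^esub> b * c mod int r = (a * d - b * c) mod int r"
    by (simp add: a_minus_def res_neg_eq res_add_eq mod_simps)
  then show ?thesis
    using assms by (auto simp: SL2_def res_carrier_eq res_mult_eq res_one_eq cong_def)
qed

lemma SL2F_mult:
  assumes "r > 1"
  shows "(a, b, c, d) \<otimes>\<^bsub>SL2F r\<^esub> (a', b', c', d') =
     ((a * a' + b * c') mod int r, (a * b' + b * d') mod int r,
      (c * a' + d * c') mod int r, (c * b' + d * d') mod int r)"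
proof -
  interpret residues "int r" "residue_ring (int r)" using assms by unfold_locales auto
  show ?thesis by (simp add: SL2_def res_mult_eq res_add_eq mod_simps)
qed

lemma SL2_reduce_hom:
  assumes "r > 1"
  shows "SL2_reduce r \<in> hom SL2Z (SL2F r)"
proof (rule homI)
  fix g assume "g \<in> carrier SL2Z"
  then show "SL2_reduce r g \<in> carrier (SL2F r)"
  proof (cases g)
    fix a b c d assume g: "g = (a, b, c, d)"
    have "[a mod int r * (d mod int r) - b mod int r * (c mod int r) = a * d - b * c] (mod int r)"
      by (intro cong_diff cong_mult) (simp_all add: cong_def)
    then show ?thesis
      using assms \<open>g \<in> carrier SL2Z\<close>
      by (simp add: g SL2Z_carrier SL2F_carrier SL2_reduce_def del: One_nat_def)
  qed
next
  fix g h
  have dot: "(a mod m * (b mod m) + c mod m * (d mod m)) mod m = (a * b + c * d) mod m"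
    for a b c d m :: int
    by (rule cong_add[unfolded cong_def]) (simp_all add: mod_simps)
  show "SL2_reduce r (g \<otimes>\<^bsub>SL2Z\<^esub> h) = SL2_reduce r g \<otimes>\<^bsub>SL2F r\<^esub> SL2_reduce r h"
    by (cases g; cases h) (simp add: SL2_mult_int SL2F_mult[OF assms] SL2_reduce_def dot)
qed

lemma SL2Z_closed: "g \<in> carrier SL2Z \<Longrightarrow> h \<in> carrier SL2Z \<Longrightarrow> g \<otimes>\<^bsub>SL2Z\<^esub> h \<in> carrier SL2Z"
proof (cases g; cases h)
  fix a b c d a' b' c' d'
  assume "g \<in> carrier SL2Z" "h \<in> carrier SL2Z" and gh: "g = (a, b, c, d)" "h = (a', b', c', d')"
  then have "a * d - b * c = 1" "a' * d' - b' * c' = 1" by (simp_all add: SL2Z_carrier)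
  then have "(a * d - b * c) * (a' * d' - b' * c') = 1" by simp
  then show ?thesis by (simp add: gh SL2Z_carrier SL2_mult_int algebra_simps)
qed

lemma SL2_s_carrier: "SL2_s \<in> carrier SL2Z" and SL2_t_carrier: "SL2_t \<in> carrier SL2Z"
  by (simp_all add: SL2_s_def SL2_t_def SL2Z_carrier)

text \<open>Since \<open>s\<^sup>-\<^sup>1 = s\<^sup>3\<close> and \<open>t\<^sup>-\<^sup>1 = s\<^sup>2 (s t)\<^sup>2 s\<close>, the elements \<open>s\<close> and \<open>t\<close> generate
  \<open>SL\<^sub>2(\<int>)\<close> even as a monoid. The proof is the Euclidean algorithm on the first column.\<close>

lemma SL2Z_induct [consumes 1, case_names s t mult]:
  assumes "g \<in> carrier SL2Z"
    and s: "Q SL2_s" and t: "Q SL2_t"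
    and mult: "\<And>g h. g \<in> carrier SL2Z \<Longrightarrow> h \<in> carrier SL2Z \<Longrightarrow> Q g \<Longrightarrow> Q h \<Longrightarrow> Q (g \<otimes>\<^bsub>SL2Z\<^esub> h)"
  shows "Q g"
proof -
  have mult': "Q (a * a' + b * c', a * b' + b * d', c * a' + d * c', c * b' + d * d')"
    if "Q (a, b, c, d)" "Q (a', b', c', d')" "a * d - b * c = 1" "a' * d' - b' * c' = 1"
    for a b c d a' b' c' d'
    using mult[of "(a, b, c, d)" "(a', b', c', d')"] that by (simp add: SL2Z_carrier SL2_mult_int)
  have S: "Q (0, -1, 1, 0)" and T: "Q (1, 1, 0, 1)" using s t by (simp_all add: SL2_s_def SL2_t_def)
  have S2: "Q (-1, 0, 0, -1)" using mult'[OF S S] by simp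
  have ST: "Q (0, -1, 1, 1)" using mult'[OF S T] by simp
  have "Q (-1, -1, 1, 0)" using mult'[OF ST ST] by simp
  from mult'[OF S2 mult'[OF this S]] have T': "Q (1, -1, 0, 1)" by simp
  have S': "Q (0, 1, -1, 0)" using mult'[OF S2 S] by simp
  have T_nat: "Q (1, int k, 0, 1) \<and> Q (1, - int k, 0, 1)" for k
  proof (induction k)
    case 0
    show ?case using mult'[OF T T'] by simp
  next
    case (Suc k)
    then show ?case using mult'[of 1 "int k" 0 1 1 1 0 1] mult'[of 1 "- int k" 0 1 1 "- 1" 0 1] T T'
      by (simp add: algebra_simps)
  qed
  have T_int: "Q (1, k, 0, 1)" for k
    using T_nat[of "nat k"] T_nat[of "nat (- k)"] by (cases "k \<ge> 0") auto
  have "Q (a, b, c, d)" if "a * d - b * c = 1" for a b c d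
    using that
  proof (induction "nat \<bar>c\<bar>" arbitrary: a b c d rule: less_induct)
    case less
    show ?case
    proof (cases "c = 0")
      case True
      then have "a * d = 1" using less.prems by simp
      then consider "a = 1" "d = 1" | "a = -1" "d = -1" by (auto simp: zmult_eq_1_iff)
      then show ?thesis
      proof cases
        case 1
        then show ?thesis using True T_int by simp
      next
        case 2
        then show ?thesis using True mult'[OF S2 T_int[of "- b"]] by simp
      qed
    next
      case False
      define q where "q = a div c"
      have a: "a mod c = a - q * c" by (simp add: q_def minus_div_mult_eq_mod)
      have smaller: "nat \<bar>- (a mod c)\<bar> < nat \<bar>c\<bar>"
        using False abs_mod_less[of c a] by simp
      \<comment> \<open>With \<open>q = a div c\<close> the matrix is \<open>t\<^sup>q s\<close> times a matrix whose lower left entry is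
        \<open>- (a mod c)\<close>.\<close>
      have det: "c * (- (b - q * d)) - d * (- (a mod c)) = 1"
        using less.prems by (simp add: a algebra_simps)
      have "Q (c, d, - (a mod c), - (b - q * d))"
        by (rule less.hyps[OF smaller det])
      from mult'[OF S this _ det] have "Q (a mod c, b - q * d, c, d)" by simp
      from mult'[OF T_int[of q] this] show ?thesis
        using less.prems by (simp add: a algebra_simps)
    qed
  qed
  then show ?thesis using assms(1) by (cases g) (simp add: SL2Z_carrier)
qed

text \<open>Strong approximation: with \<open>c\<close> invertible modulo \<open>r\<close>, the matrix is the product of
  two upper unitriangular matrices and a lower one between them, each of which lifts; a vanishing
  \<open>c\<close> is removed by a multiplication with \<open>s\<close>.\<close>

lemma SL2_reduce_surj:
  assumes "prime r" and "\<alpha> \<in> carrier (SL2F r)"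
  shows "\<exists>g \<in> carrier SL2Z. SL2_reduce r g = \<alpha>"
proof -
  have r: "prime (int r)" "r > 1" using assms(1) prime_gt_1_nat by auto
  have main: "\<exists>a' b' c' d'. a' * d' - b' * c' = 1 \<and> [a' = a] (mod int r) \<and> [b' = b] (mod int r) \<and>
      [c' = c] (mod int r) \<and> [d' = d] (mod int r)"
    if det: "[a * d - b * c = 1] (mod int r)" and c: "\<not> int r dvd c" for a b c d
  proof -
    have "coprime c (int r)" using c r(1) by (metis coprime_commute prime_imp_coprime)
    then obtain w where w: "[c * w = 1] (mod int r)" using cong_solve_coprime_int by blast
    define u v where "u = w * (a - 1)" and "v = w * (d - 1)"
    have u: "[1 + u * c = a] (mod int r)"
      using cong_add[OF cong_refl[of 1] cong_mult[OF w cong_refl[of "a - 1"]]]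
      by (simp add: u_def algebra_simps)
    have v: "[c * v + 1 = d] (mod int r)"
      using cong_add[OF cong_refl[of 1] cong_mult[OF w cong_refl[of "d - 1"]]]
      by (simp add: v_def algebra_simps)
    define b' where "b' = (1 + u * c) * v + u"
    have det': "(1 + u * c) * (c * v + 1) - b' * c = 1" by (simp add: b'_def algebra_simps)
    have "[b' * c = (1 + u * c) * (c * v + 1) - 1] (mod int r)" using det' by (simp add: algebra_simps)
    also have "[(1 + u * c) * (c * v + 1) - 1 = a * d - 1] (mod int r)"
      by (intro cong_diff cong_mult u v cong_refl)
    also have "[a * d - 1 = b * c] (mod int r)"
      using det by (simp add: cong_iff_dvd_diff algebra_simps)
    finally have "[b' = b] (mod int r)"
      using \<open>coprime c (int r)\<close> cong_mult_rcancel by blast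
    then show ?thesis using det' u v by (intro exI[of _ c] exI conjI) (auto simp: mult.commute)
  qed
  obtain a b c d where \<alpha>: "\<alpha> = (a, b, c, d)" by (cases \<alpha>)
  have b: "a \<in> {0..<int r}" "b \<in> {0..<int r}" "c \<in> {0..<int r}" "d \<in> {0..<int r}"
    and det: "[a * d - b * c = 1] (mod int r)"
    using assms(2) r(2) by (auto simp: \<alpha> SL2F_carrier)
  have "\<exists>a' b' c' d'. a' * d' - b' * c' = 1 \<and> [a' = a] (mod int r) \<and> [b' = b] (mod int r) \<and>
      [c' = c] (mod int r) \<and> [d' = d] (mod int r)"
  proof (cases "int r dvd c")
    case False
    then show ?thesis by (rule main[OF det])
  next
    case True
    have "\<not> int r dvd a"
    proof
      assume "int r dvd a"
      then have "int r dvd a * d - b * c" using True by simp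
      then show False using det r by (metis cong_dvd_iff not_prime_unit)
    qed
    moreover have "[(- c) * b - (- d) * a = 1] (mod int r)" using det by (simp add: algebra_simps)
    ultimately obtain p q p' q' where "p * q' - q * p' = 1" "[p = - c] (mod int r)"
      "[q = - d] (mod int r)" "[p' = a] (mod int r)" "[q' = b] (mod int r)"
      using main[of "- c" b "- d" a] by blast
    then show ?thesis
      by (intro exI[of _ p'] exI[of _ q'] exI[of _ "- p"] exI[of _ "- q"])
         (auto simp: algebra_simps dest: cong_minus_minus_iff[THEN iffD2])
  qed
  then obtain a' b' c' d' where g: "a' * d' - b' * c' = 1" "[a' = a] (mod int r)" "[b' = b] (mod int r)"
      "[c' = c] (mod int r)" "[d' = d] (mod int r)" by blast
  have "SL2_reduce r (a', b', c', d') = \<alpha>" using g b by (simp add: \<alpha> SL2_reduce_def cong_def)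
  then show ?thesis using g(1) by (auto simp: SL2Z_carrier)
qed

text \<open>The relations \<open>s\<^sup>4 = 1\<close>, \<open>(s t)\<^sup>3 = s\<^sup>2\<close> and \<open>t\<^sup>r = 1\<close> make the abelianisation of
  \<open>SL\<^sub>2(\<F>\<^sub>r)\<close> a group of exponent dividing \<open>12\<close>; it is generated by
  the image of \<open>t\<close>, whose order divides \<open>r\<close>, which is coprime to \<open>12\<close>.\<close>

lemma SL2F_char_trivial:
  fixes \<chi> :: "int \<times> int \<times> int \<times> int \<Rightarrow> complex"
  assumes "prime r" "r \<ge> 5"
    and mult: "\<And>\<alpha> \<beta>. \<alpha> \<in> carrier (SL2F r) \<Longrightarrow> \<beta> \<in> carrier (SL2F r) \<Longrightarrow>
      \<chi> (\<alpha> \<otimes>\<^bsub>SL2F r\<^esub> \<beta>) = \<chi> \<alpha> * \<chi> \<beta>"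
    and nz: "\<And>\<alpha>. \<alpha> \<in> carrier (SL2F r) \<Longrightarrow> \<chi> \<alpha> \<noteq> 0"
    and \<alpha>: "\<alpha> \<in> carrier (SL2F r)"
  shows "\<chi> \<alpha> = 1"
proof -
  have r: "r > 1" using assms(2) by simp
  define f where "f = \<chi> \<circ> SL2_reduce r"
  have f_mult: "f (g \<otimes>\<^bsub>SL2Z\<^esub> h) = f g * f h" if "g \<in> carrier SL2Z" "h \<in> carrier SL2Z" for g h
    using that mult hom_mult[OF SL2_reduce_hom[OF r]] hom_in_carrier[OF SL2_reduce_hom[OF r]]
    by (simp add: f_def)
  have f_nz: "f g \<noteq> 0" if "g \<in> carrier SL2Z" for g
    using that nz hom_in_carrier[OF SL2_reduce_hom[OF r]] by (simp add: f_def)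
  have f_mult': "f (a * a' + b * c', a * b' + b * d', c * a' + d * c', c * b' + d * d') =
      f (a, b, c, d) * f (a', b', c', d')" if "a * d - b * c = 1" "a' * d' - b' * c' = 1"
    for a b c d a' b' c' d'
    using f_mult[of "(a, b, c, d)" "(a', b', c', d')"] that by (simp add: SL2Z_carrier SL2_mult_int)
  define x y where "x = f (0, -1, 1, 0)" and "y = f (1, 1, 0, 1)"
  have x0: "x \<noteq> 0" and y0: "y \<noteq> 0" and f10: "f (1, 0, 0, 1) \<noteq> 0"
    by (auto simp: x_def y_def SL2Z_carrier intro!: f_nz)
  have f1: "f (1, 0, 0, 1) = 1" using f_mult'[of 1 1 0 0 1 1 0 0] f10 by simp
  have xx: "f (-1, 0, 0, -1) = x * x" using f_mult'[of 0 0 "-1" 1 0 0 "-1" 1] by (simp add: x_def)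
  have x4: "x ^ 4 = 1"
    using f_mult'[of "-1" "-1" 0 0 "-1" "-1" 0 0] xx f1 by (simp add: power4_eq_xxxx mult.assoc)
  have xy: "f (0, -1, 1, 1) = x * y" using f_mult'[of 0 0 "-1" 1 1 1 1 0] by (simp add: x_def y_def)
  have "f (-1, -1, 1, 0) = (x * y) ^ 2"
    using f_mult'[of 0 1 "-1" 1 0 1 "-1" 1] xy by (simp add: power2_eq_square)
  then have "x * x = (x * y) ^ 3"
    using f_mult'[of "-1" 0 "-1" 1 0 1 "-1" 1] xy xx by (simp add: power3_eq_cube power2_eq_square)
  then have "x * y ^ 3 = 1"
    using x0 by (simp add: power3_eq_cube field_simps)
  then have "(x * y ^ 3) ^ 4 = 1" by simp
  then have y12: "y ^ 12 = 1" using x4 by (simp add: power_mult_distrib flip: power_mult)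
  have "f (1, int k, 0, 1) = y ^ k" for k
  proof (induction k)
    case (Suc k)
    then show ?case using f_mult'[of 1 1 1 0 1 1 "int k" 0] by (simp add: y_def algebra_simps)
  qed (simp add: f1)
  moreover have "f (1, int r, 0, 1) = f (1, 0, 0, 1)" by (simp add: f_def SL2_reduce_def)
  ultimately have yr: "y ^ r = 1" using f1 by simp
  have "coprime r 12"
  proof -
    have "\<not> r dvd 2" "\<not> r dvd 3" using assms(2) by (auto dest: dvd_imp_le)
    then have "\<not> r dvd 2 * (2 * 3)" using assms(1) by (simp only: prime_dvd_mult_iff) simp
    then have "coprime r (2 * (2 * 3))" by (rule prime_imp_coprime[OF assms(1)])
    then show ?thesis by simp
  qed
  then obtain u v where uv: "r * u = 12 * v + 1"
    using bezout_nat[of r 12] assms(2) by auto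
  have "y = y ^ (12 * v + 1)" by (simp add: power_mult y12)
  also have "\<dots> = 1" unfolding uv[symmetric] by (simp add: power_mult yr)
  finally have y: "y = 1" .
  then have x: "x = 1" using \<open>x * y ^ 3 = 1\<close> by simp
  have one: "f g = 1" if "g \<in> carrier SL2Z" for g
    using that
  proof (induction rule: SL2Z_induct)
    case s
    show ?case using x by (simp add: x_def SL2_s_def)
  next
    case t
    show ?case using y by (simp add: y_def SL2_t_def)
  next
    case (mult g h)
    then show ?case by (simp add: f_mult)
  qed
  obtain g where "g \<in> carrier SL2Z" "SL2_reduce r g = \<alpha>"
    using SL2_reduce_surj[OF assms(1) \<alpha>] by blast
  then show ?thesis using one[of g] by (simp add: f_def)
qed



section \<open>Roots of unity\<close>

lemma root_e_add: "root_e r (j + k) = root_e r j * root_e r k"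
  unfolding root_e_def exp_add[symmetric] by (simp add: ring_distribs add_divide_distrib)

lemma root_e_0 [simp]: "root_e r 0 = 1"
  by (simp add: root_e_def)

lemma root_e_nonzero [simp]: "root_e r k \<noteq> 0"
  by (simp add: root_e_def)

lemma root_e_minus: "root_e r (- k) = inverse (root_e r k)"
  using root_e_add[of r k "- k"] by (simp add: inverse_unique)

lemma root_e_cis: "root_e r k = cis (2 * pi * of_int k / of_nat r)"
  by (simp add: root_e_def cis_conv_exp mult_ac)

lemma root_e_eq_1_iff:
  assumes "r > 0"
  shows "root_e r k = 1 \<longleftrightarrow> int r dvd k"
proof -
  have "root_e r k = 1 \<longleftrightarrow> (\<exists>m::int. 2 * pi * of_int k / of_nat r = of_int m * (2 * pi))"
    by (simp add: root_e_cis cis_eq_1_iff)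
  also have "\<dots> \<longleftrightarrow> (\<exists>m::int. (of_int k :: real) = of_int (m * int r))"
    using assms by (intro ex_cong1) (simp add: field_simps)
  also have "\<dots> \<longleftrightarrow> int r dvd k"
    unfolding of_int_eq_iff by (auto simp: dvd_def mult.commute)
  finally show ?thesis .
qed

lemma root_e_eq_iff:
  assumes "r > 0"
  shows "root_e r j = root_e r k \<longleftrightarrow> [j = k] (mod int r)"
proof -
  have "root_e r j = root_e r (j - k) * root_e r k" by (simp flip: root_e_add)
  then have "root_e r j = root_e r k \<longleftrightarrow> root_e r (j - k) = 1" by simp
  then show ?thesis using assms by (simp add: root_e_eq_1_iff cong_iff_dvd_diff)
qed

lemma root_e_power: "root_e r k ^ n = root_e r (k * int n)"
  by (induction n) (simp_all add: root_e_add ring_distribs)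

lemma root_e_sum:
  assumes "r > 0"
  shows "(\<Sum>j<r. root_e r (k * int j)) = (if int r dvd k then of_nat r else 0)"
proof (cases "int r dvd k")
  case True
  then have "root_e r (k * int j) = 1" for j using assms by (simp add: root_e_eq_1_iff)
  then show ?thesis using True by simp
next
  case False
  have "(\<Sum>j<r. root_e r (k * int j)) = (root_e r k ^ r - 1) / (root_e r k - 1)"
    using False assms by (simp add: geometric_sum root_e_eq_1_iff flip: root_e_power)
  also have "root_e r k ^ r = 1"
    using assms by (simp add: root_e_power root_e_eq_1_iff)
  finally show ?thesis using False by simp
qed


section \<open>The Heisenberg action and its intertwiners\<close>

lemma Heis_carrier: "(k, m, n) \<in> carrier (Heis r) \<longleftrightarrow>
    k \<in> {0..<int r} \<and> m \<in> {0..<int r} \<and> n \<in> {0..<int r}"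
  by (simp add: Heis_def)

lemma Heis_mult: "(k, m, n) \<otimes>\<^bsub>Heis r\<^esub> (k', m', n') =
    ((k + k' + 2 * n * m') mod int r, (m + m') mod int r, (n + n') mod int r)"
  by (simp add: Heis_def)

text \<open>The exponent of \<open>z\<close> collects \<open>2 m n\<close> for each of the \<open>j (j - 1) / 2\<close> transpositions of a
  \<open>y\<^sup>n\<close> with an \<open>x\<^sup>m\<close>.\<close>

lemma Heis_pow:
  assumes "r > 0"
  shows "(k mod int r, m mod int r, n mod int r) [^]\<^bsub>Heis r\<^esub> j =
    ((int j * k + int j * (int j - 1) * m * n) mod int r, (int j * m) mod int r, (int j * n) mod int r)"
proof (induction j)
  case 0
  show ?case by (simp add: Heis_def)
next
  case (Suc j)
  have "[(int j * k + int j * (int j - 1) * m * n) mod int r + k mod int r +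
      2 * ((int j * n) mod int r) * (m mod int r)
      = int j * k + int j * (int j - 1) * m * n + k + 2 * (int j * n) * m] (mod int r)"
    by (intro cong_add cong_mult cong_refl) (simp_all add: cong_def)
  also have "int j * k + int j * (int j - 1) * m * n + k + 2 * (int j * n) * m =
      int (Suc j) * k + int (Suc j) * (int (Suc j) - 1) * m * n"
    by (simp add: algebra_simps)
  finally have 1: "((int j * k + int j * (int j - 1) * m * n) mod int r + k mod int r +
      2 * ((int j * n) mod int r) * (m mod int r)) mod int r =
      (int (Suc j) * k + int (Suc j) * (int (Suc j) - 1) * m * n) mod int r"
    by (simp only: cong_def)
  have 2: "((int j * l) mod int r + l mod int r) mod int r = (int (Suc j) * l) mod int r" for l
    by (simp add: mod_simps algebra_simps)
  show ?case
    unfolding nat_pow_Suc Suc.IH Heis_mult 1 2 ..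
qed

text \<open>The symmetrised elements \<open>w(m, n) = z\<^sup>m\<^sup>n x\<^sup>m y\<^sup>n\<close> satisfy \<open>f\<^sub>M (w v) = w (M v)\<close>. Since
  \<open>(k, m, n) = z\<^sup>k\<^sup>-\<^sup>m\<^sup>n w(m, n)\<close>, the exponent of \<open>z\<close> changes by the difference of the products of
  the two coordinates.\<close>

lemma heis_act_eq:
  assumes "r > 1" "(a, b, c, d) \<in> carrier (SL2F r)" "(k, m, n) \<in> carrier (Heis r)"
  shows "heis_act r (a, b, c, d) (k, m, n) =
    ((k - m * n + (a * m + b * n) * (c * m + d * n)) mod int r, (a * m + b * n) mod int r,
     (c * m + d * n) mod int r)"
proof -
  have nn: "0 \<le> a" "0 \<le> b" "0 \<le> c" "0 \<le> d" "0 \<le> k" "0 \<le> m" "0 \<le> n"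
    using assms by (auto simp: SL2F_carrier Heis_carrier)
  have det: "[a * d - b * c = 1] (mod int r)" using assms by (simp add: SL2F_carrier)
  have gen: "heis_x = (0 mod int r, 1 mod int r, 0 mod int r)"
    "heis_y = (0 mod int r, 0 mod int r, 1 mod int r)" "heis_z = (1 mod int r, 0 mod int r, 0 mod int r)"
    using assms(1) by (simp_all add: heis_x_def heis_y_def heis_z_def)
  have pow: "(k mod int r, m mod int r, n mod int r) [^]\<^bsub>Heis r\<^esub> j =
    ((j * k + j * (j - 1) * m * n) mod int r, (j * m) mod int r, (j * n) mod int r)"
    if "0 \<le> j" for k m n j
  proof -
    have "j = int (nat j)" using that by simp
    then have "(k mod int r, m mod int r, n mod int r) [^]\<^bsub>Heis r\<^esub> j =
        (k mod int r, m mod int r, n mod int r) [^]\<^bsub>Heis r\<^esub> nat j"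
      by (metis int_pow_int)
    also have "\<dots> = ((int (nat j) * k + int (nat j) * (int (nat j) - 1) * m * n) mod int r,
        (int (nat j) * m) mod int r, (int (nat j) * n) mod int r)"
      using assms(1) by (intro Heis_pow) simp
    finally show ?thesis using that by simp
  qed
  have fx: "heis_z [^]\<^bsub>Heis r\<^esub> (u * v) \<otimes>\<^bsub>Heis r\<^esub> heis_x [^]\<^bsub>Heis r\<^esub> u \<otimes>\<^bsub>Heis r\<^esub> heis_y [^]\<^bsub>Heis r\<^esub> v
     = ((u * v) mod int r, u mod int r, v mod int r)" if "0 \<le> u" "0 \<le> v" for u v
    using that by (simp only: gen pow mult_nonneg_nonneg Heis_mult) (simp add: mod_simps)
  have "heis_act r (a, b, c, d) (k, m, n) =
     (k mod int r, 0, 0) \<otimes>\<^bsub>Heis r\<^esub>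
       ((m * (a * c) + m * (m - 1) * a * c) mod int r, (m * a) mod int r, (m * c) mod int r) \<otimes>\<^bsub>Heis r\<^esub>
       ((n * (b * d) + n * (n - 1) * b * d) mod int r, (n * b) mod int r, (n * d) mod int r)"
    unfolding heis_act_def split Let_def fx[OF nn(1,3)] fx[OF nn(2,4)] pow[OF nn(6)] pow[OF nn(7)]
    using nn(5) by (simp only: gen pow) simp
  also have "\<dots> = ((k + m * m * a * c + n * n * b * d + 2 * (m * c) * (n * b)) mod int r,
      (a * m + b * n) mod int r, (c * m + d * n) mod int r)"
  proof -
    define X Y where "X = m * (a * c) + m * (m - 1) * a * c" and "Y = n * (b * d) + n * (n - 1) * b * d"
    have "[(k mod int r + X mod int r + 2 * 0 * ((m * a) mod int r)) mod int r + Y mod int r +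
        2 * ((0 + m * c mod int r) mod int r) * ((n * b) mod int r) =
        (k + X + 2 * 0 * (m * a)) + Y + 2 * (0 + m * c) * (n * b)] (mod int r)"
      by (intro cong_add cong_mult cong_refl ) (simp_all add: cong_def mod_simps)
    also have "(k + X + 2 * 0 * (m * a)) + Y + 2 * (0 + m * c) * (n * b) =
        k + m * m * a * c + n * n * b * d + 2 * (m * c) * (n * b)"
      by (simp add: X_def Y_def algebra_simps)
    finally have "((k mod int r + X mod int r + 2 * 0 * ((m * a) mod int r)) mod int r + Y mod int r +
        2 * ((0 + m * c mod int r) mod int r) * ((n * b) mod int r)) mod int r =
        (k + m * m * a * c + n * n * b * d + 2 * (m * c) * (n * b)) mod int r"
      by (simp only: cong_def)
    moreover have "((0 + u * v mod int r) mod int r + w * x mod int r) mod int r = (v * u + x * w) mod int r"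
      for u v w x by (simp add: mod_simps mult.commute)
    ultimately show ?thesis unfolding Heis_mult X_def Y_def by (simp only:)
  qed
  finally have act: "heis_act r (a, b, c, d) (k, m, n) =
      ((k + m * m * a * c + n * n * b * d + 2 * (m * c) * (n * b)) mod int r,
       (a * m + b * n) mod int r, (c * m + d * n) mod int r)" .
  have "k + m * m * a * c + n * n * b * d + 2 * (m * c) * (n * b) =
      k - m * n * (a * d - b * c) + (a * m + b * n) * (c * m + d * n)"
    by (simp add: algebra_simps)
  also have "[k - m * n * (a * d - b * c) + (a * m + b * n) * (c * m + d * n) =
      k - m * n * 1 + (a * m + b * n) * (c * m + d * n)] (mod int r)"
    by (intro cong_add cong_diff cong_mult cong_refl det)
  finally show ?thesis unfolding act by (simp add: cong_def)
qed

lemma heis_act_carrier: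
  assumes "r > 1" "\<alpha> \<in> carrier (SL2F r)" "h \<in> carrier (Heis r)"
  shows "heis_act r \<alpha> h \<in> carrier (Heis r)"
  using assms by (cases \<alpha>; cases h) (simp add: heis_act_eq Heis_carrier)

lemma heis_act_mult:
  assumes "r > 1" "\<alpha> \<in> carrier (SL2F r)" "\<beta> \<in> carrier (SL2F r)" "\<alpha> \<otimes>\<^bsub>SL2F r\<^esub> \<beta> \<in> carrier (SL2F r)"
    "h \<in> carrier (Heis r)"
  shows "heis_act r (\<alpha> \<otimes>\<^bsub>SL2F r\<^esub> \<beta>) h = heis_act r \<alpha> (heis_act r \<beta> h)"
proof -
  obtain a b c d where \<alpha>: "\<alpha> = (a, b, c, d)" by (cases \<alpha>)
  obtain a' b' c' d' where \<beta>: "\<beta> = (a', b', c', d')" by (cases \<beta>)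
  obtain k m n where h: "h = (k, m, n)" by (cases h)
  define M N where "M = a' * m + b' * n" and "N = c' * m + d' * n"
  note [simp] = SL2F_mult[OF assms(1)]
  have \<beta>h: "heis_act r \<beta> h = ((k - m * n + M * N) mod int r, M mod int r, N mod int r)"
    using assms by (simp add: \<beta> h heis_act_eq M_def N_def)
  have "heis_act r \<alpha> (heis_act r \<beta> h) =
    (((k - m * n + M * N) mod int r - (M mod int r) * (N mod int r) +
       (a * (M mod int r) + b * (N mod int r)) * (c * (M mod int r) + d * (N mod int r))) mod int r,
     (a * (M mod int r) + b * (N mod int r)) mod int r, (c * (M mod int r) + d * (N mod int r)) mod int r)"
    using assms heis_act_carrier[OF assms(1,3,5)] unfolding \<beta>h \<alpha> by (intro heis_act_eq)
  also have "\<dots> = ((k - m * n + (a * M + b * N) * (c * M + d * N)) mod int r,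
     (a * M + b * N) mod int r, (c * M + d * N) mod int r)"
  proof -
    have M: "[M mod int r = M] (mod int r)" and N: "[N mod int r = N] (mod int r)"
      by (simp_all add: cong_def)
    have "[(k - m * n + M * N) mod int r - (M mod int r) * (N mod int r) +
       (a * (M mod int r) + b * (N mod int r)) * (c * (M mod int r) + d * (N mod int r)) =
       (k - m * n + M * N) - M * N + (a * M + b * N) * (c * M + d * N)] (mod int r)"
      by (intro cong_add cong_diff cong_mult cong_refl M N) (simp add: cong_def)
    moreover have "[u * (M mod int r) + v * (N mod int r) = u * M + v * N] (mod int r)" for u v
      by (intro cong_add cong_mult cong_refl M N)
    ultimately show ?thesis by (simp add: cong_def)
  qed
  also have "\<dots> = heis_act r (\<alpha> \<otimes>\<^bsub>SL2F r\<^esub> \<beta>) h"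
  proof -
    define p q u v where "p = a * a' + b * c'" and "q = a * b' + b * d'"
      and "u = c * a' + d * c'" and "v = c * b' + d * d'"
    have pq: "a * M + b * N = p * m + q * n" "c * M + d * N = u * m + v * n"
      by (simp_all add: M_def N_def p_def q_def u_def v_def algebra_simps)
    have prod: "\<alpha> \<otimes>\<^bsub>SL2F r\<^esub> \<beta> = (p mod int r, q mod int r, u mod int r, v mod int r)"
      by (simp add: \<alpha> \<beta> p_def q_def u_def v_def)
    have "heis_act r (\<alpha> \<otimes>\<^bsub>SL2F r\<^esub> \<beta>) h =
      ((k - m * n + (p mod int r * m + q mod int r * n) * (u mod int r * m + v mod int r * n)) mod int r,
       (p mod int r * m + q mod int r * n) mod int r, (u mod int r * m + v mod int r * n) mod int r)"
      using assms(4,5) unfolding prod h by (intro heis_act_eq assms(1))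
    moreover have "[k - m * n + (p mod int r * m + q mod int r * n) * (u mod int r * m + v mod int r * n)
       = k - m * n + (p * m + q * n) * (u * m + v * n)] (mod int r)"
      by (intro cong_add cong_diff cong_mult cong_refl) (simp_all add: cong_def)
    moreover have "[x mod int r * m + y mod int r * n = x * m + y * n] (mod int r)" for x y
      by (intro cong_add cong_mult cong_refl) (simp_all add: cong_def)
    ultimately show ?thesis unfolding pq by (simp add: cong_def)
  qed
  finally show ?thesis by simp
qed

lemma svn_X_pow: "svn_X r ^\<^sub>m p = mat r r (\<lambda>(i, j). if i = j then root_e r (2 * int p * int i) else 0)"
proof (induction p)
  case 0
  show ?case by (auto simp: svn_X_def)
next
  case (Suc p)
  show ?case
    unfolding pow_mat.simps Suc
    by (intro eq_matI)
       (auto simp: svn_X_def scalar_prod_def if_distrib[of "\<lambda>x. x * _"] if_distrib[of "\<lambda>x. _ * x"]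
         sum.delta algebra_simps cong: if_cong simp flip: root_e_add)
qed

lemma svn_Y_pow:
  assumes "r > 0"
  shows "svn_Y r ^\<^sub>m p = mat r r (\<lambda>(i, j). if int i = (int j - int p) mod int r then 1 else 0)"
proof (induction p)
  case 0
  show ?case by (auto simp: svn_Y_def)
next
  case (Suc p)
  show ?case
    unfolding pow_mat.simps Suc
  proof (intro eq_matI)
    fix i j
    assume "i < dim_row (mat r r (\<lambda>(i, j). if int i = (int j - int (Suc p)) mod int r then 1 else (0::complex)))"
      and "j < dim_col (mat r r (\<lambda>(i, j). if int i = (int j - int (Suc p)) mod int r then 1 else (0::complex)))"
    then have ij: "i < r" "j < r" by auto
    define l where "l = nat ((int j - 1) mod int r)"
    have l: "l < r" "(int j - 1) mod int r = int l" using assms by (auto simp: l_def nat_less_iff)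
    have "(mat r r (\<lambda>(i, j). if int i = (int j - int p) mod int r then 1 else 0) * svn_Y r) $$ (i, j)
      = (\<Sum>k = 0..<r. (if int i = (int k - int p) mod int r then 1 else 0) * (if k = l then 1 else 0))"
      using ij l by (simp add: svn_Y_def scalar_prod_def)
    also have "\<dots> = (if int i = (int l - int p) mod int r then 1 else 0)"
      using l(1) by (simp add: if_distrib[of "\<lambda>x. _ * x"] sum.delta cong: if_cong)
    also have "(int l - int p) mod int r = (int j - int (Suc p)) mod int r"
      by (simp add: l(2)[symmetric] mod_simps algebra_simps)
    finally show "(mat r r (\<lambda>(i, j). if int i = (int j - int p) mod int r then 1 else 0) * svn_Y r) $$ (i, j)
      = mat r r (\<lambda>(i, j). if int i = (int j - int (Suc p)) mod int r then 1 else 0) $$ (i, j)"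
      using ij by simp
  qed (simp_all add: svn_Y_def)
qed

text \<open>The representing matrices are monomial: \<open>x\<^sup>m y\<^sup>n\<close> maps \<open>e\<^sub>j\<close> to a multiple of \<open>e\<^sub>i\<close> with
  \<open>i \<equiv> j - n\<close>.\<close>

lemma svn_rep_eq:
  assumes "r > 0" "(k, m, n) \<in> carrier (Heis r)"
  shows "svn_rep r (k, m, n) =
    mat r r (\<lambda>(i, j). if int i = (int j - n) mod int r then root_e r (k + 2 * m * int i) else 0)"
proof -
  have "0 \<le> m" "0 \<le> n" using assms by (auto simp: Heis_carrier)
  then show ?thesis
    unfolding svn_rep_def split svn_X_pow svn_Y_pow[OF assms(1)]
    by (intro eq_matI)
       (auto simp: scalar_prod_def if_distrib[of "\<lambda>x. x * _"] sum.delta root_e_add cong: if_cong)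
qed

lemma svn_rep_carrier: "svn_rep r h \<in> carrier_mat r r"
  by (cases h) (auto simp: svn_rep_def svn_X_def svn_Y_def intro!: smult_carrier_mat mult_carrier_mat pow_carrier_mat)

lemma mult_svn_rep:
  assumes "(k, m, n) \<in> carrier (Heis r)" "M \<in> carrier_mat r r" "i < r" "j < r" "l < r"
    and l: "int l = (int j - n) mod int r"
  shows "(M * svn_rep r (k, m, n)) $$ (i, j) = M $$ (i, l) * root_e r (k + 2 * m * int l)"
proof -
  have "(M * svn_rep r (k, m, n)) $$ (i, j) =
    (\<Sum>p = 0..<r. M $$ (i, p) * (if p = l then root_e r (k + 2 * m * int p) else 0))"
    using assms by (simp add: svn_rep_eq scalar_prod_def flip: l)
  then show ?thesis using assms by (simp add: if_distrib[of "\<lambda>x. _ * x"] sum.delta cong: if_cong)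
qed

lemma svn_rep_mult:
  assumes "(k, m, n) \<in> carrier (Heis r)" "M \<in> carrier_mat r r" "i < r" "j < r" "l < r"
    and l: "int l = (int i + n) mod int r"
  shows "(svn_rep r (k, m, n) * M) $$ (i, j) = root_e r (k + 2 * m * int i) * M $$ (l, j)"
proof -
  have *: "int i = (int p - n) mod int r \<longleftrightarrow> p = l" if "p < r" for p
  proof -
    have "int i = (int p - n) mod int r \<longleftrightarrow> [int i = int p - n] (mod int r)"
      using assms by (simp add: cong_def)
    also have "\<dots> \<longleftrightarrow> [int i + n = int p] (mod int r)"
      by (simp add: cong_iff_dvd_diff algebra_simps)
    also have "\<dots> \<longleftrightarrow> int l = int p" using that by (simp add: cong_def l)
    finally show ?thesis by auto
  qed
  have "(svn_rep r (k, m, n) * M) $$ (i, j) =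
    (\<Sum>p = 0..<r. (if p = l then root_e r (k + 2 * m * int i) else 0) * M $$ (p, j))"
    using assms by (simp add: svn_rep_eq scalar_prod_def *)
  then show ?thesis using assms by (simp add: if_distrib[of "\<lambda>x. x * _"] sum.delta cong: if_cong)
qed

lemma weil_intertwiner_iff:
  assumes "r > 1" "\<alpha> \<in> carrier (SL2F r)"
  shows "weil_intertwiner r \<alpha> R \<longleftrightarrow> R \<in> carrier_mat r r \<and> det R \<noteq> 0 \<and>
    (\<forall>h \<in> carrier (Heis r). R * svn_rep r h = svn_rep r (heis_act r \<alpha> h) * R)"
proof (cases "R \<in> carrier (GL r)")
  case True
  interpret group "GL r" by (rule GL_group)
  note R = True
  let ?I = "inv\<^bsub>GL r\<^esub> R"
  have inv: "?I \<in> carrier_mat r r" "?I * R = 1\<^sub>m r" "R * ?I = 1\<^sub>m r"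
    using inv_closed[OF R] l_inv[OF R] r_inv[OF R] by (simp_all add: carrier_GL)
  have Rc: "R \<in> carrier_mat r r" using R by (simp add: carrier_GL)
  note assoc = assoc_mult_mat[of _ r r _ r _ r]
  have "R * M * ?I = N \<longleftrightarrow> R * M = N * R" if "M \<in> carrier_mat r r" "N \<in> carrier_mat r r" for M N
  proof
    assume "R * M * ?I = N"
    then have "N * R = R * M * ?I * R" by simp
    also have "\<dots> = R * M * (?I * R)" using that(1) Rc inv(1) by (simp only: assoc mult_carrier_mat[of _ r r _ r])
    finally have "N * R = R * M * (?I * R)" .
    then show "R * M = N * R" using inv that Rc by simp
  next
    assume "R * M = N * R"
    then have "R * M * ?I = N * R * ?I" by simp
    also have "\<dots> = N * (R * ?I)" using that(2) Rc inv(1) by (simp only: assoc mult_carrier_mat[of _ r r _ r])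
    finally have "R * M * ?I = N * (R * ?I)" .
    then show "R * M * ?I = N" using inv that Rc by simp
  qed
  then show ?thesis
    using R by (simp add: weil_intertwiner_def svn_rep_carrier) (simp add: carrier_GL)
qed (auto simp: weil_intertwiner_def carrier_GL)

lemma weil_intertwiner_mult:
  assumes "r > 1" "\<alpha> \<in> carrier (SL2F r)" "\<beta> \<in> carrier (SL2F r)" "\<alpha> \<otimes>\<^bsub>SL2F r\<^esub> \<beta> \<in> carrier (SL2F r)"
    and R: "weil_intertwiner r \<alpha> R" and R': "weil_intertwiner r \<beta> R'"
  shows "weil_intertwiner r (\<alpha> \<otimes>\<^bsub>SL2F r\<^esub> \<beta>) (R * R')"
proof -
  note iff = weil_intertwiner_iff[OF assms(1)]
  have c: "R \<in> carrier_mat r r" "R' \<in> carrier_mat r r" "det R \<noteq> 0" "det R' \<noteq> 0"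
    using R R' assms by (auto simp: iff)
  have "R * R' * svn_rep r h = svn_rep r (heis_act r (\<alpha> \<otimes>\<^bsub>SL2F r\<^esub> \<beta>) h) * (R * R')"
    if h: "h \<in> carrier (Heis r)" for h
  proof -
    note [simp] = svn_rep_carrier
    have "R * R' * svn_rep r h = R * (R' * svn_rep r h)"
      using c by (simp add: assoc_mult_mat[of _ r r _ r _ r])
    also have "\<dots> = R * svn_rep r (heis_act r \<beta> h) * R'"
      using c R' h assms by (simp add: iff assoc_mult_mat[of _ r r _ r _ r])
    also have "\<dots> = svn_rep r (heis_act r \<alpha> (heis_act r \<beta> h)) * R * R'"
      using c R assms heis_act_carrier[OF assms(1,3) h] by (simp add: iff)
    finally show ?thesis
      using c by (simp add: heis_act_mult[OF assms(1-4) h] assoc_mult_mat[of _ r r _ r _ r])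
  qed
  then show ?thesis using c assms by (simp add: iff det_mult[of _ r])
qed

text \<open>Schur's lemma for the Stone--von Neumann representation: commuting with \<open>x\<close> makes a
  matrix diagonal, as the eigenvalues \<open>e(2k)\<close> of \<open>x\<close> are distinct, and commuting with \<open>y\<close> makes
  its diagonal constant.\<close>

lemma svn_commutant:
  assumes "odd r" "r > 1" "M \<in> carrier_mat r r"
    and comm: "\<And>h. h \<in> carrier (Heis r) \<Longrightarrow> M * svn_rep r h = svn_rep r h * M"
  shows "\<exists>c. M = c \<cdot>\<^sub>m 1\<^sub>m r"
proof -
  have x: "(0, 1, 0) \<in> carrier (Heis r)" and y: "(0, 0, 1) \<in> carrier (Heis r)"
    using assms(2) by (simp_all add: Heis_carrier)
  have diag: "M $$ (i, j) = 0" if "i < r" "j < r" "i \<noteq> j" for i j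
  proof -
    have "M $$ (i, j) * root_e r (2 * int j) = root_e r (2 * int i) * M $$ (i, j)"
      using comm[OF x] mult_svn_rep[OF x assms(3) that(1,2), of j]
        svn_rep_mult[OF x assms(3) that(1,2), of i] that by auto
    moreover have "root_e r (2 * int j) \<noteq> root_e r (2 * int i)"
    proof
      assume "root_e r (2 * int j) = root_e r (2 * int i)"
      then have "[2 * int j = 2 * int i] (mod int r)" using assms(2) by (simp add: root_e_eq_iff)
      moreover have "coprime 2 (int r)" using assms(1) by simp
      ultimately have "[int j = int i] (mod int r)" by (simp add: cong_mult_lcancel)
      then show False using that by (simp add: cong_def)
    qed
    ultimately show ?thesis by auto
  qed
  have step: "M $$ (Suc i, Suc i) = M $$ (i, i)" if "Suc i < r" for i
    using comm[OF y] mult_svn_rep[OF y assms(3), of i "Suc i" i]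
      svn_rep_mult[OF y assms(3), of i "Suc i" "Suc i"] that by simp
  have const: "M $$ (i, i) = M $$ (0, 0)" if "i < r" for i
    using that by (induction i) (auto simp: step)
  have "M = M $$ (0, 0) \<cdot>\<^sub>m 1\<^sub>m r"
    using assms(3) by (intro eq_matI) (auto simp: diag intro: const)
  then show ?thesis by blast
qed

lemma weil_intertwiner_unique:
  assumes "odd r" "r > 1" "\<alpha> \<in> carrier (SL2F r)"
    and R: "weil_intertwiner r \<alpha> R" and R': "weil_intertwiner r \<alpha> R'"
  shows "\<exists>c. c \<noteq> 0 \<and> R' = c \<cdot>\<^sub>m R"
proof -
  interpret group "GL r" by (rule GL_group)
  note iff = weil_intertwiner_iff[OF assms(2,3)]
  let ?I = "inv\<^bsub>GL r\<^esub> R"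
  have c: "R \<in> carrier_mat r r" "R' \<in> carrier_mat r r" "det R \<noteq> 0" "det R' \<noteq> 0"
    using R R' by (auto simp: iff)
  then have G: "R \<in> carrier (GL r)" by (simp add: carrier_GL)
  have inv: "?I \<in> carrier_mat r r" "?I * R = 1\<^sub>m r" "R * ?I = 1\<^sub>m r"
    using inv_closed[OF G] l_inv[OF G] r_inv[OF G] by (simp_all add: carrier_GL)
  note assoc = assoc_mult_mat[of _ r r _ r _ r]
  have "?I * R' * svn_rep r h = svn_rep r h * (?I * R')" if h: "h \<in> carrier (Heis r)" for h
  proof -
    note [simp] = svn_rep_carrier
    let ?h = "svn_rep r (heis_act r \<alpha> h)"
    have RM: "R * svn_rep r h = ?h * R" "R' * svn_rep r h = ?h * R'" using R R' h by (auto simp: iff)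
    have "?I * R' * svn_rep r h = ?I * (?h * 1\<^sub>m r) * R'"
      using c inv(1) RM right_mult_one_mat[OF svn_rep_carrier] by (simp add: assoc)
    also have "\<dots> = ?I * (?h * (R * ?I)) * R'" by (simp only: inv(3))
    also have "\<dots> = ?I * (?h * R) * ?I * R'"
      using c inv(1) by (simp add: assoc mult_carrier_mat[of _ r r _ r])
    also have "\<dots> = (?I * R) * svn_rep r h * ?I * R'"
      unfolding RM(1)[symmetric] using c inv(1) by (simp add: assoc)
    also have "\<dots> = svn_rep r h * (?I * R')" using c inv(1)
      by (simp add: inv(2) assoc mult_carrier_mat[of _ r r _ r] left_mult_one_mat[of _ r r])
    finally show ?thesis .
  qed
  from svn_commutant[OF assms(1,2) _ this] obtain d where d: "?I * R' = d \<cdot>\<^sub>m 1\<^sub>m r"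
    using c inv by auto
  have "R' = R * ?I * R'" using c inv by simp
  also have "\<dots> = R * (d \<cdot>\<^sub>m 1\<^sub>m r)" using c inv(1) by (simp add: assoc d)
  also have "\<dots> = d \<cdot>\<^sub>m R" using c by (simp add: mult_scalar_mat[where m = r])
  finally have R'd: "R' = d \<cdot>\<^sub>m R" .
  moreover have "d \<noteq> 0"
  proof
    assume "d = 0"
    then have "det R' = 0" using c assms(2) by (simp add: R'd)
    then show False using c by simp
  qed
  ultimately show ?thesis by blast
qed



section \<open>Restriction to odd vectors\<close>

text \<open>The number \<open>n\<close> is the dimension of the space of odd vectors.\<close>

locale weil_level =
  fixes r n :: nat
  assumes r_prime: "prime r" and r_ge_5: "r \<ge> 5" and n_eq: "n = (r - 1) div 2"
begin

lemma r_odd: "odd r" and r_eq: "r = 2 * n + 1" and r_gt_1: "r > 1"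
proof -
  show "odd r" using r_prime r_ge_5 prime_odd_nat[of r] by simp
  then show "r = 2 * n + 1" by (auto simp: n_eq elim: oddE)
  show "r > 1" using r_ge_5 by simp
qed

text \<open>The columns of \<open>B\<close> are the basis \<open>e\<^sub>k - e\<^sub>-\<^sub>k\<close>, \<open>1 \<le> k \<le> n\<close>, of the space of odd vectors,
  and \<open>C\<close> reads off the coordinates of an odd vector in this basis.\<close>

definition B :: "complex mat" where "B = mat_of_cols r (odd_basis r)"

definition C :: "complex mat" where "C = mat n r (\<lambda>(a, i). if i = a + 1 then 1 else 0)"

text \<open>The matrix, in this basis, of the restriction of \<open>M\<close> to the odd vectors. It is meaningful only
  if \<open>M\<close> maps odd vectors to odd vectors, which is what \<open>preserves_odd\<close> says.\<close>

definition odd_part :: "complex mat \<Rightarrow> complex mat" where "odd_part M = C * (M * B)"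

definition preserves_odd :: "complex mat \<Rightarrow> bool" where
  "preserves_odd M \<longleftrightarrow> M * B = B * odd_part M"

lemma length_odd_basis: "length (odd_basis r) = n"
  by (simp add: odd_basis_def n_eq)

lemma B_carrier [simp]: "B \<in> carrier_mat r n"
  unfolding B_def using mat_of_cols_carrier(1)[of r "odd_basis r"] by (simp add: length_odd_basis)

lemma C_carrier [simp]: "C \<in> carrier_mat n r"
  by (simp add: C_def)

lemma odd_part_carrier [simp]: "M \<in> carrier_mat r r \<Longrightarrow> odd_part M \<in> carrier_mat n n"
  unfolding odd_part_def by (metis B_carrier C_carrier mult_carrier_mat)

lemma B_index:
  assumes "i < r" "b < n"
  shows "B $$ (i, b) = (if i = b + 1 then 1 else if i = r - 1 - b then -1 else 0)"
proof -
  have pos: "int (b + 1) mod int r = int (b + 1)"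
    by (rule mod_pos_pos_trivial) (use assms r_eq in auto)
  moreover have "(- int (b + 1)) mod int r = int (r - 1 - b)"
    unfolding zmod_zminus1_eq_if pos using assms r_eq by (simp add: of_nat_diff)
  ultimately have "odd_vec r (int (b + 1)) = unit_vec r (b + 1) - unit_vec r (r - 1 - b)"
    unfolding odd_vec_def by (simp only: nat_int)
  moreover have "odd_basis r ! b = odd_vec r (int (b + 1))"
  proof -
    have "[1..<n + 1] ! b = 1 + b" using assms(2) by (intro nth_upt) simp
    then show ?thesis
      using assms(2) unfolding odd_basis_def n_eq[symmetric] by (simp del: upt_Suc)
  qed
  moreover have "b + 1 < r" "r - 1 - b < r" "b + 1 \<noteq> r - 1 - b" using assms r_eq by auto
  ultimately show ?thesis
    using assms by (auto simp: B_def mat_of_cols_index length_odd_basis)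
qed

lemma C_mult:
  assumes "M \<in> carrier_mat r m" "a < n" "b < m"
  shows "(C * M) $$ (a, b) = M $$ (a + 1, b)"
proof -
  have "(C * M) $$ (a, b) = (\<Sum>i = 0..<r. (if i = a + 1 then 1 else 0) * M $$ (i, b))"
    using assms by (simp add: C_def scalar_prod_def)
  then show ?thesis
    using assms r_eq by (simp add: if_distrib[of "\<lambda>x. x * _"] sum.delta cong: if_cong)
qed

lemma mult_B:
  assumes "M \<in> carrier_mat m r" "i < m" "b < n"
  shows "(M * B) $$ (i, b) = M $$ (i, b + 1) - M $$ (i, r - 1 - b)"
proof -
  have b: "b + 1 < r" "r - 1 - b < r" "b + 1 \<noteq> r - 1 - b" using assms(3) r_eq by auto
  have "(M * B) $$ (i, b) = (\<Sum>k = 0..<r. M $$ (i, k) * B $$ (k, b))"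
    using assms carrier_matD[OF B_carrier] by (simp add: scalar_prod_def)
  also have "\<dots> = (\<Sum>k = 0..<r. (if k = b + 1 then M $$ (i, k) else 0) - (if k = r - 1 - b then M $$ (i, k) else 0))"
    using assms(3) b(3) by (intro sum.cong) (auto simp: B_index)
  also have "\<dots> = M $$ (i, b + 1) - M $$ (i, r - 1 - b)"
    unfolding sum_subtractf using b by (simp add: sum.delta)
  finally show ?thesis .
qed

lemma C_B: "C * B = 1\<^sub>m n"
proof (intro eq_matI)
  fix a b assume "a < dim_row (1\<^sub>m n)" "b < dim_col (1\<^sub>m n)"
  then have ab: "a < n" "b < n" by auto
  then have "a + 1 < r" "a + 1 \<noteq> r - 1 - b" using r_eq by auto
  then show "(C * B) $$ (a, b) = 1\<^sub>m n $$ (a, b)"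
    using ab C_mult[OF B_carrier ab] B_index[of "a + 1" b] by auto
qed (use carrier_matD[OF B_carrier] carrier_matD[OF C_carrier] in auto)

lemma B_C_odd:
  assumes M: "M \<in> carrier_mat r n"
    and odd: "\<And>i b. i < r \<Longrightarrow> b < n \<Longrightarrow> M $$ ((r - i) mod r, b) = - M $$ (i, b)"
  shows "B * (C * M) = M"
proof (intro eq_matI)
  fix i b assume "i < dim_row M" "b < dim_col M"
  then have i: "i < r" and b: "b < n" using M by auto
  have CM: "C * M \<in> carrier_mat n n" by (rule mult_carrier_mat[OF C_carrier M])
  have "(B * (C * M)) $$ (i, b) = (\<Sum>a = 0..<n. B $$ (i, a) * (C * M) $$ (a, b))"
    using i b carrier_matD[OF B_carrier] carrier_matD[OF CM] by (simp add: scalar_prod_def)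
  also have "\<dots> = (\<Sum>a = 0..<n. (if i = a + 1 then 1 else if i = r - 1 - a then -1 else 0) * M $$ (a + 1, b))"
    using i b by (intro sum.cong) (auto simp: B_index C_mult[OF M])
  also have "\<dots> = M $$ (i, b)"
  proof -
    consider "i = 0" | "1 \<le> i" "i \<le> n" | "n < i" by linarith
    then show ?thesis
    proof cases
      case 1
      have "M $$ (0, b) = - M $$ (0, b)" using odd[of 0 b] r_gt_1 b by simp
      then have "M $$ (0, b) = 0" by simp
      moreover have "(if i = a + 1 then 1 else if i = r - 1 - a then -1 else 0) = (0 :: complex)"
        if "a < n" for a using that 1 r_eq by auto
      ultimately show ?thesis using 1 by (simp add: sum.neutral)
    next
      case 2
      have "(\<Sum>a = 0..<n. (if i = a + 1 then 1 else if i = r - 1 - a then -1 else 0) * M $$ (a + 1, b))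
        = (\<Sum>a = 0..<n. if a = i - 1 then M $$ (i, b) else 0)"
        using 2 r_eq by (intro sum.cong) auto
      then show ?thesis using 2 by (simp add: sum.delta)
    next
      case 3
      have "M $$ (r - i, b) = - M $$ (i, b)" using odd[OF i b] 3 i by simp
      moreover have "(\<Sum>a = 0..<n. (if i = a + 1 then 1 else if i = r - 1 - a then -1 else 0) * M $$ (a + 1, b))
        = (\<Sum>a = 0..<n. if a = r - 1 - i then - M $$ (r - i, b) else 0)"
        using 3 i r_eq by (intro sum.cong) (auto simp: Suc_diff_Suc)
      moreover have "r - 1 - i < n" using 3 r_eq i by linarith
      ultimately show ?thesis by (simp add: sum.delta)
    qed
  qed
  finally show "(B * (C * M)) $$ (i, b) = M $$ (i, b)" .
qed (use M carrier_matD[OF B_carrier] in auto)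

text \<open>A matrix commuting with the reflection \<open>e\<^sub>k \<mapsto> e\<^sub>-\<^sub>k\<close> preserves the odd vectors. In these
  zero-based indices the reflection is \<open>i \<mapsto> (r - i) mod r\<close>.\<close>

lemma preserves_oddI:
  assumes M: "M \<in> carrier_mat r r"
    and even: "\<And>i j. i < r \<Longrightarrow> j < r \<Longrightarrow> M $$ ((r - i) mod r, (r - j) mod r) = M $$ (i, j)"
  shows "preserves_odd M"
  unfolding preserves_odd_def odd_part_def
proof (rule B_C_odd[symmetric])
  show "M * B \<in> carrier_mat r n" using M by simp
  fix i b assume i: "i < r" and b: "b < n"
  have neg: "(r - (b + 1)) mod r = r - 1 - b" "(r - (r - 1 - b)) mod r = b + 1"
    using b r_eq by auto
  show "(M * B) $$ ((r - i) mod r, b) = - (M * B) $$ (i, b)"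
  proof -
    have "b + 1 < r" "r - 1 - b < r" "(r - i) mod r < r" using b r_eq by auto
    then show ?thesis
      using even[OF i, of "b + 1"] even[OF i, of "r - 1 - b"] b i unfolding neg
      by (simp add: mult_B[OF M])
  qed
qed

lemma odd_part_unique:
  assumes "M \<in> carrier_mat r r" "N \<in> carrier_mat n n" "M * B = B * N"
  shows "N = odd_part M"
proof -
  have "odd_part M = C * B * N"
    using assms assoc_mult_mat[OF C_carrier B_carrier assms(2)] by (simp add: odd_part_def)
  then show ?thesis using assms(2) by (simp add: C_B)
qed

lemma odd_part_mult:
  assumes M: "M \<in> carrier_mat r r" "M' \<in> carrier_mat r r" and "preserves_odd M" "preserves_odd M'"
  shows "odd_part (M * M') = odd_part M * odd_part M'" and "preserves_odd (M * M')"
proof -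
  have "M * M' * B = M * (M' * B)" using M by (simp add: assoc_mult_mat[of _ r r _ r _ n])
  also have "\<dots> = M * (B * odd_part M')" using assms by (simp add: preserves_odd_def)
  also have "\<dots> = M * B * odd_part M'"
    using assoc_mult_mat[OF M(1) B_carrier odd_part_carrier[OF M(2)]] by simp
  also have "\<dots> = B * odd_part M * odd_part M'" using assms by (simp add: preserves_odd_def)
  also have "\<dots> = B * (odd_part M * odd_part M')"
    using assoc_mult_mat[OF B_carrier odd_part_carrier[OF M(1)] odd_part_carrier[OF M(2)]] .
  finally have eq: "M * M' * B = B * (odd_part M * odd_part M')" .
  show *: "odd_part (M * M') = odd_part M * odd_part M'"
    using odd_part_unique[OF _ _ eq] M by (metis mult_carrier_mat odd_part_carrier)
  show "preserves_odd (M * M')" unfolding preserves_odd_def * by (rule eq)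
qed

lemma odd_part_smult:
  assumes "M \<in> carrier_mat r r"
  shows "odd_part (c \<cdot>\<^sub>m M) = c \<cdot>\<^sub>m odd_part M"
proof -
  have "c \<cdot>\<^sub>m M * B = c \<cdot>\<^sub>m (M * B)" by (rule mult_smult_assoc_mat[OF assms B_carrier])
  moreover have "M * B \<in> carrier_mat r n" using assms by simp
  ultimately show ?thesis unfolding odd_part_def using mult_smult_distrib[OF C_carrier] by simp
qed

lemma preserves_odd_smult:
  assumes "M \<in> carrier_mat r r" "preserves_odd M"
  shows "preserves_odd (c \<cdot>\<^sub>m M)"
proof -
  have "c \<cdot>\<^sub>m M * B = c \<cdot>\<^sub>m (M * B)" by (rule mult_smult_assoc_mat[OF assms(1) B_carrier])
  also have "\<dots> = B * (c \<cdot>\<^sub>m odd_part M)"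
    using assms mult_smult_distrib[OF B_carrier odd_part_carrier[OF assms(1)]]
    by (simp add: preserves_odd_def)
  finally show ?thesis by (simp add: preserves_odd_def odd_part_smult assms)
qed

lemma det_odd_part:
  assumes M: "M \<in> carrier_mat r r" "preserves_odd M" "det M \<noteq> 0"
  shows "det (odd_part M) \<noteq> 0"
proof
  assume "det (odd_part M) = 0"
  then obtain v where v: "v \<in> carrier_vec n" "v \<noteq> 0\<^sub>v n" "odd_part M *\<^sub>v v = 0\<^sub>v n"
    using det_0_iff_vec_prod_zero[OF odd_part_carrier[OF M(1)]] by blast
  have Bv: "B *\<^sub>v v \<in> carrier_vec r" using mult_mat_vec_carrier[OF B_carrier v(1)] .
  have "M *\<^sub>v (B *\<^sub>v v) = M * B *\<^sub>v v" using assoc_mult_mat_vec[OF M(1) B_carrier v(1)] by simp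
  also have "\<dots> = B *\<^sub>v (odd_part M *\<^sub>v v)"
    using M(2) assoc_mult_mat_vec[OF B_carrier odd_part_carrier[OF M(1)] v(1)]
    by (simp add: preserves_odd_def)
  also have "\<dots> = 0\<^sub>v r" unfolding v(3) using carrier_matD[OF B_carrier] by auto
  finally have "B *\<^sub>v v = 0\<^sub>v r" using M(3) Bv det_0_iff_vec_prod_zero[OF M(1)] by blast
  then have "C * B *\<^sub>v v = 0\<^sub>v n"
    using assoc_mult_mat_vec[OF C_carrier B_carrier v(1)] carrier_matD[OF C_carrier] by auto
  then show False using v by (simp add: C_B)
qed

lemma restriction_mat_odd:
  assumes M: "M \<in> carrier_mat r r" "preserves_odd M"
  shows "restriction_mat r (odd_basis r) M = odd_part M"
  unfolding restriction_mat_def length_odd_basis B_def[symmetric]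
  using assms odd_part_unique[OF M(1)] by (intro the_equality) (auto simp: preserves_odd_def)


section \<open>The Weil representation\<close>

text \<open>Explicit intertwiners over \<open>s\<close> and \<open>t\<close>: the finite Fourier transform
  \<open>e\<^sub>k \<mapsto> \<Sum>\<^sub>j e(2 j k) e\<^sub>j\<close> and the Gaussian \<open>e\<^sub>k \<mapsto> e(- k\<^sup>2) e\<^sub>k\<close>.\<close>

definition weil_S :: "complex mat" where
  "weil_S = mat r r (\<lambda>(i, j). root_e r (2 * int i * int j))"

definition weil_T :: "complex mat" where
  "weil_T = mat r r (\<lambda>(i, j). if i = j then root_e r (- (int i * int i)) else 0)"

lemma weil_S_carrier [simp]: "weil_S \<in> carrier_mat r r"
  and weil_T_carrier [simp]: "weil_T \<in> carrier_mat r r"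
  by (simp_all add: weil_S_def weil_T_def)

lemma reduce_carrier: "g \<in> carrier SL2Z \<Longrightarrow> SL2_reduce r g \<in> carrier (SL2F r)"
  by (rule hom_in_carrier[OF SL2_reduce_hom[OF r_gt_1]])

lemma SL2F_closed:
  assumes "\<alpha> \<in> carrier (SL2F r)" "\<beta> \<in> carrier (SL2F r)"
  shows "\<alpha> \<otimes>\<^bsub>SL2F r\<^esub> \<beta> \<in> carrier (SL2F r)"
  using assms SL2_reduce_surj[OF r_prime] hom_mult[OF SL2_reduce_hom[OF r_gt_1]]
    reduce_carrier SL2Z_closed by metis

lemma reduce_s: "SL2_reduce r SL2_s = (0, int r - 1, 1, 0)"
  and reduce_t: "SL2_reduce r SL2_t = (1, 1, 0, 1)"
  using r_gt_1 by (simp_all add: SL2_reduce_def SL2_s_def SL2_t_def zmod_minus1)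

text \<open>Fourier inversion gives an inverse up to the factor \<open>r\<close>.\<close>

lemma det_weil_S: "det weil_S \<noteq> 0"
proof -
  define W where "W = mat r r (\<lambda>(i, j). root_e r (- (2 * int i * int j)))"
  have W: "W \<in> carrier_mat r r" by (simp add: W_def)
  have "weil_S * W = of_nat r \<cdot>\<^sub>m 1\<^sub>m r"
  proof (intro eq_matI)
    fix i j assume "i < dim_row (of_nat r \<cdot>\<^sub>m 1\<^sub>m r)" "j < dim_col (of_nat r \<cdot>\<^sub>m 1\<^sub>m r)"
    then have ij: "i < r" "j < r" by auto
    have "(weil_S * W) $$ (i, j) = (\<Sum>p<r. root_e r (2 * (int i - int j) * int p))"
      using ij by (simp add: weil_S_def W_def scalar_prod_def atLeast0LessThan algebra_simps
          flip: root_e_add)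
    also have "\<dots> = (if int r dvd 2 * (int i - int j) then of_nat r else 0)"
      using r_gt_1 by (simp add: root_e_sum)
    also have "int r dvd 2 * (int i - int j) \<longleftrightarrow> i = j"
    proof -
      have "int r dvd 2 * (int i - int j) \<longleftrightarrow> int r dvd int i - int j"
        using r_odd by (intro coprime_dvd_mult_right_iff) simp
      also have "\<dots> \<longleftrightarrow> [int i = int j] (mod int r)" by (simp add: cong_iff_dvd_diff)
      also have "\<dots> \<longleftrightarrow> i = j" using ij by (simp add: cong_def)
      finally show ?thesis .
    qed
    finally show "(weil_S * W) $$ (i, j) = (of_nat r \<cdot>\<^sub>m 1\<^sub>m r) $$ (i, j)" using ij by simp
  qed (simp_all add: weil_S_def W_def)
  then have "det weil_S * det W = of_nat r ^ r"
    using det_mult[OF weil_S_carrier W] by simp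
  then show ?thesis using r_gt_1 by auto
qed

lemma det_weil_T: "det weil_T \<noteq> 0"
proof -
  have "upper_triangular weil_T" by (auto simp: upper_triangular_def weil_T_def)
  then have "det weil_T = prod_list (diag_mat weil_T)"
    by (rule det_upper_triangular[OF _ weil_T_carrier])
  moreover have "0 \<notin> set (diag_mat weil_T)" by (auto simp: diag_mat_def weil_T_def)
  ultimately show ?thesis by (simp add: prod_list_zero_iff)
qed

lemma preserves_odd_weil_S: "preserves_odd weil_S"
proof (rule preserves_oddI[OF weil_S_carrier])
  fix i j assume ij: "i < r" "j < r"
  have neg: "[int ((r - i) mod r) = - int i] (mod int r)" if "i < r" for i
    using that by (simp add: cong_def zmod_int of_nat_diff)
  have "[2 * int ((r - i) mod r) * int ((r - j) mod r) = 2 * (- int i) * (- int j)] (mod int r)"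
    by (intro cong_mult cong_refl neg ij)
  then show "weil_S $$ ((r - i) mod r, (r - j) mod r) = weil_S $$ (i, j)"
    using ij r_gt_1 by (simp add: weil_S_def root_e_eq_iff)
qed

lemma preserves_odd_weil_T: "preserves_odd weil_T"
proof (rule preserves_oddI[OF weil_T_carrier])
  fix i j assume ij: "i < r" "j < r"
  have neg: "[int ((r - i) mod r) = - int i] (mod int r)" if "i < r" for i
    using that by (simp add: cong_def zmod_int of_nat_diff)
  have "[int ((r - i) mod r) * int ((r - i) mod r) = (- int i) * (- int i)] (mod int r)"
    by (intro cong_mult neg ij)
  then have "[- (int ((r - i) mod r) * int ((r - i) mod r)) = - (int i * int i)] (mod int r)"
    by (simp add: cong_minus_minus_iff)
  moreover have "(r - i) mod r = (r - j) mod r \<longleftrightarrow> i = j"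
  proof
    assume "(r - i) mod r = (r - j) mod r"
    then have "[- int i = - int j] (mod int r)"
      using neg[OF ij(1)] neg[OF ij(2)] by (metis cong_sym cong_trans)
    then show "i = j" using ij by (simp add: cong_minus_minus_iff) (simp add: cong_def)
  qed simp
  ultimately show "weil_T $$ ((r - i) mod r, (r - j) mod r) = weil_T $$ (i, j)"
    using ij r_gt_1 by (cases "i = j") (simp_all add: weil_T_def root_e_eq_iff)
qed

lemma weil_intertwiner_S: "weil_intertwiner r (SL2_reduce r SL2_s) weil_S"
proof -
  have s: "(0, int r - 1, 1, 0) \<in> carrier (SL2F r)"
    using reduce_carrier[OF SL2_s_carrier] by (simp add: reduce_s)
  have "weil_S * svn_rep r h = svn_rep r (heis_act r (0, int r - 1, 1, 0) h) * weil_S"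
    if h: "h \<in> carrier (Heis r)" for h
  proof (cases h)
    fix k m u assume hh: "h = (k, m, u)"
    define k' m' where "k' = (k - m * u + (int r - 1) * u * m) mod int r"
      and "m' = ((int r - 1) * u) mod int r"
    have act: "heis_act r (0, int r - 1, 1, 0) h = (k', m', m mod int r)"
      using heis_act_eq[OF r_gt_1 s h[unfolded hh]] by (simp add: hh k'_def m'_def)
    have mcar: "m mod int r = m" using h by (simp add: hh Heis_carrier)
    have h': "(k', m', m) \<in> carrier (Heis r)"
      using heis_act_carrier[OF r_gt_1 s h] by (simp add: act mcar)
    show ?thesis
      unfolding act mcar unfolding hh
    proof (intro eq_matI)
      fix i j assume "i < dim_row (svn_rep r (k', m', m) * weil_S)"
        and "j < dim_col (svn_rep r (k', m', m) * weil_S)"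
      then have ij: "i < r" "j < r"
        using carrier_matD[OF svn_rep_carrier] by (auto simp: weil_S_def)
      define p q where "p = nat ((int j - u) mod int r)" and "q = nat ((int i + m) mod int r)"
      have p: "p < r" "int p = (int j - u) mod int r" and q: "q < r" "int q = (int i + m) mod int r"
        using r_gt_1 by (auto simp: p_def q_def nat_less_iff)
      have pc: "[int p = int j - u] (mod int r)" and qc: "[int q = int i + m] (mod int r)"
        by (simp_all add: p q cong_def)
      have r1: "[int r - 1 = -1] (mod int r)" by (simp add: cong_def)
      have kc: "[k' = k - m * u + (-1) * u * m] (mod int r)"
        using cong_add[OF cong_refl cong_mult[OF cong_mult[OF r1 cong_refl] cong_refl]]
        by (simp add: k'_def cong_def)
      have mc: "[m' = (-1) * u] (mod int r)"
        using cong_mult[OF r1 cong_refl] by (simp add: m'_def cong_def)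
      have "[2 * int i * int p + (k + 2 * m * int p) =
          2 * int i * (int j - u) + (k + 2 * m * (int j - u))] (mod int r)"
        by (intro cong_add cong_mult cong_refl pc)
      also have "2 * int i * (int j - u) + (k + 2 * m * (int j - u)) =
          (k - m * u + (-1) * u * m + 2 * ((-1) * u) * int i) + 2 * (int i + m) * int j"
        by (simp add: algebra_simps)
      also have "[\<dots> = (k' + 2 * m' * int i) + 2 * int q * int j] (mod int r)"
        by (intro cong_add cong_mult cong_refl qc[THEN cong_sym] kc[THEN cong_sym] mc[THEN cong_sym])
      finally have "root_e r (2 * int i * int p + (k + 2 * m * int p)) =
          root_e r ((k' + 2 * m' * int i) + 2 * int q * int j)"
        using r_gt_1 by (simp add: root_e_eq_iff)
      then have "weil_S $$ (i, p) * root_e r (k + 2 * m * int p) =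
          root_e r (k' + 2 * m' * int i) * weil_S $$ (q, j)"
        using ij p q by (simp add: weil_S_def root_e_add)
      then show "(weil_S * svn_rep r (k, m, u)) $$ (i, j) = (svn_rep r (k', m', m) * weil_S) $$ (i, j)"
        using mult_svn_rep[OF h[unfolded hh] weil_S_carrier ij p]
          svn_rep_mult[OF h' weil_S_carrier ij q] by simp
    qed (use carrier_matD[OF svn_rep_carrier] in \<open>auto simp: weil_S_def\<close>)
  qed
  then show ?thesis
    unfolding reduce_s weil_intertwiner_iff[OF r_gt_1 s] by (simp add: det_weil_S)
qed

lemma weil_intertwiner_T: "weil_intertwiner r (SL2_reduce r SL2_t) weil_T"
proof -
  have t: "(1, 1, 0, 1) \<in> carrier (SL2F r)"
    using reduce_carrier[OF SL2_t_carrier] by (simp add: reduce_t)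
  have "weil_T * svn_rep r h = svn_rep r (heis_act r (1, 1, 0, 1) h) * weil_T"
    if h: "h \<in> carrier (Heis r)" for h
  proof (cases h)
    fix k m u assume hh: "h = (k, m, u)"
    define k' m' where "k' = (k - m * u + (m + u) * u) mod int r" and "m' = (m + u) mod int r"
    have act: "heis_act r (1, 1, 0, 1) h = (k', m', u mod int r)"
      using heis_act_eq[OF r_gt_1 t h[unfolded hh]] by (simp add: hh k'_def m'_def)
    have ucar: "u mod int r = u" using h by (simp add: hh Heis_carrier)
    have h': "(k', m', u) \<in> carrier (Heis r)"
      using heis_act_carrier[OF r_gt_1 t h] by (simp add: act ucar)
    show ?thesis
      unfolding act ucar unfolding hh
    proof (intro eq_matI)
      fix i j assume "i < dim_row (svn_rep r (k', m', u) * weil_T)"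
        and "j < dim_col (svn_rep r (k', m', u) * weil_T)"
      then have ij: "i < r" "j < r"
        using carrier_matD[OF svn_rep_carrier] by (auto simp: weil_T_def)
      define p q where "p = nat ((int j - u) mod int r)" and "q = nat ((int i + u) mod int r)"
      have p: "p < r" "int p = (int j - u) mod int r" and q: "q < r" "int q = (int i + u) mod int r"
        using r_gt_1 by (auto simp: p_def q_def nat_less_iff)
      have pc: "[int p = int j - u] (mod int r)" and qc: "[int q = int i + u] (mod int r)"
        by (simp_all add: p q cong_def)
      have kc: "[k' = k - m * u + (m + u) * u] (mod int r)" and mc: "[m' = m + u] (mod int r)"
        by (simp_all add: k'_def m'_def cong_def)
      have pq: "i = p \<longleftrightarrow> q = j"
      proof -
        have "i = p \<longleftrightarrow> [int i = int p] (mod int r)" using ij p(1) by (simp add: cong_def)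
        also have "\<dots> \<longleftrightarrow> [int i = int j - u] (mod int r)" using pc by (metis cong_sym cong_trans)
        also have "\<dots> \<longleftrightarrow> [int i + u = int j] (mod int r)" by (simp add: cong_iff_dvd_diff algebra_simps)
        also have "\<dots> \<longleftrightarrow> [int q = int j] (mod int r)" using qc by (metis cong_sym cong_trans)
        also have "\<dots> \<longleftrightarrow> q = j" using ij q(1) by (simp add: cong_def)
        finally show ?thesis .
      qed
      have "[- (int i * int i) + (k + 2 * m * int i) =
          (k - m * u + (m + u) * u + 2 * (m + u) * int i) + - ((int i + u) * (int i + u))] (mod int r)"
        by (simp add: algebra_simps)
      also have "[(k - m * u + (m + u) * u + 2 * (m + u) * int i) + - ((int i + u) * (int i + u)) =
          (k' + 2 * m' * int i) + - (int q * int q)] (mod int r)"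
        by (intro cong_add cong_mult cong_refl cong_minus_minus_iff[THEN iffD2]
            qc[THEN cong_sym] kc[THEN cong_sym] mc[THEN cong_sym])
      finally have "root_e r (- (int i * int i)) * root_e r (k + 2 * m * int i) =
          root_e r (k' + 2 * m' * int i) * root_e r (- (int q * int q))"
        using r_gt_1 by (simp only: root_e_add[symmetric] root_e_eq_iff)
      then have "weil_T $$ (i, p) * root_e r (k + 2 * m * int p) =
          root_e r (k' + 2 * m' * int i) * weil_T $$ (q, j)"
        using ij p(1) q(1) pq by (auto simp: weil_T_def)
      then show "(weil_T * svn_rep r (k, m, u)) $$ (i, j) = (svn_rep r (k', m', u) * weil_T) $$ (i, j)"
        using mult_svn_rep[OF h[unfolded hh] weil_T_carrier ij p]
          svn_rep_mult[OF h' weil_T_carrier ij q] by simp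
    qed (use carrier_matD[OF svn_rep_carrier] in \<open>auto simp: weil_T_def\<close>)
  qed
  then show ?thesis
    unfolding reduce_t weil_intertwiner_iff[OF r_gt_1 t] by (simp add: det_weil_T)
qed

lemma weil_intertwinerD:
  assumes "weil_intertwiner r \<alpha> R"
  shows "R \<in> carrier_mat r r" "det R \<noteq> 0"
  using assms by (auto simp: weil_intertwiner_def carrier_GL)

lemma weil_intertwiner_exists:
  assumes "\<alpha> \<in> carrier (SL2F r)"
  shows "\<exists>R. weil_intertwiner r \<alpha> R \<and> preserves_odd R"
proof -
  have "\<exists>R. weil_intertwiner r (SL2_reduce r g) R \<and> preserves_odd R" if "g \<in> carrier SL2Z" for g
    using that
  proof (induction rule: SL2Z_induct)
    case s
    show ?case using weil_intertwiner_S preserves_odd_weil_S by blast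
  next
    case t
    show ?case using weil_intertwiner_T preserves_odd_weil_T by blast
  next
    case (mult g h)
    then obtain R R' where R: "weil_intertwiner r (SL2_reduce r g) R" "preserves_odd R"
      and R': "weil_intertwiner r (SL2_reduce r h) R'" "preserves_odd R'" by blast
    have "SL2_reduce r (g \<otimes>\<^bsub>SL2Z\<^esub> h) = SL2_reduce r g \<otimes>\<^bsub>SL2F r\<^esub> SL2_reduce r h"
      by (rule hom_mult[OF SL2_reduce_hom[OF r_gt_1] mult.hyps])
    moreover have "weil_intertwiner r (SL2_reduce r g \<otimes>\<^bsub>SL2F r\<^esub> SL2_reduce r h) (R * R')"
      using mult.hyps by (intro weil_intertwiner_mult r_gt_1 reduce_carrier SL2F_closed R R')
    moreover have "preserves_odd (R * R')"
      using R R' by (intro odd_part_mult weil_intertwinerD(1))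
    ultimately show ?case by auto
  qed
  then show ?thesis using SL2_reduce_surj[OF r_prime assms] by blast
qed

lemma weil_intertwiner_preserves_odd:
  assumes "\<alpha> \<in> carrier (SL2F r)" "weil_intertwiner r \<alpha> R"
  shows "preserves_odd R"
proof -
  obtain R0 where R0: "weil_intertwiner r \<alpha> R0" "preserves_odd R0"
    using weil_intertwiner_exists[OF assms(1)] by blast
  obtain c where "R = c \<cdot>\<^sub>m R0"
    using weil_intertwiner_unique[OF r_odd r_gt_1 assms(1) R0(1) assms(2)] by blast
  then show ?thesis using preserves_odd_smult[OF weil_intertwinerD(1)[OF R0(1)] R0(2)] by simp
qed

lemma weil_intertwiner_smult:
  assumes "\<alpha> \<in> carrier (SL2F r)" "weil_intertwiner r \<alpha> R" "c \<noteq> 0"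
  shows "weil_intertwiner r \<alpha> (c \<cdot>\<^sub>m R)"
proof -
  have R: "R \<in> carrier_mat r r" "det R \<noteq> 0"
    "R * svn_rep r h = svn_rep r (heis_act r \<alpha> h) * R" if "h \<in> carrier (Heis r)" for h
    using assms that by (auto simp: weil_intertwiner_iff[OF r_gt_1 assms(1)])
  note D = weil_intertwinerD[OF assms(2)]
  show ?thesis
    unfolding weil_intertwiner_iff[OF r_gt_1 assms(1)]
  proof (intro conjI ballI)
    fix h assume h: "h \<in> carrier (Heis r)"
    show "c \<cdot>\<^sub>m R * svn_rep r h = svn_rep r (heis_act r \<alpha> h) * (c \<cdot>\<^sub>m R)"
      using mult_smult_assoc_mat[OF D(1) svn_rep_carrier] mult_smult_distrib[OF svn_rep_carrier D(1)]
        R(3)[OF h] by simp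
  qed (use D assms(3) in auto)
qed

text \<open>A quantity attached to the intertwiners that is multiplicative and, as
  \<open>r - 2 n = 1\<close>, homogeneous of degree one. The normalisation \<open>\<delta> = 1\<close> therefore picks one intertwiner
  over each element of \<open>SL\<^sub>2(\<F>\<^sub>r)\<close>, and this choice is multiplicative: it is the linear lift.\<close>

definition \<delta> :: "complex mat \<Rightarrow> complex" where
  "\<delta> R = det R / (det (odd_part R))\<^sup>2"

lemma \<delta>_nonzero:
  assumes "\<alpha> \<in> carrier (SL2F r)" "weil_intertwiner r \<alpha> R"
  shows "\<delta> R \<noteq> 0"
  using det_odd_part[OF weil_intertwinerD(1)[OF assms(2)] weil_intertwiner_preserves_odd[OF assms]]
    weil_intertwinerD(2)[OF assms(2)] by (simp add: \<delta>_def)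

lemma \<delta>_smult:
  assumes "R \<in> carrier_mat r r" "c \<noteq> 0"
  shows "\<delta> (c \<cdot>\<^sub>m R) = c * \<delta> R"
proof -
  have "\<delta> (c \<cdot>\<^sub>m R) = c ^ r * det R / (c ^ n * det (odd_part R))\<^sup>2"
    using assms carrier_matD[OF odd_part_carrier[OF assms(1)]]
    by (simp add: \<delta>_def odd_part_smult)
  also have "c ^ r = c * (c ^ n)\<^sup>2"
    by (simp add: r_eq power_mult mult.commute flip: power_mult)
  finally show ?thesis using assms(2) by (simp add: \<delta>_def power_mult_distrib)
qed

lemma \<delta>_mult:
  assumes "\<alpha> \<in> carrier (SL2F r)" "\<beta> \<in> carrier (SL2F r)"
    "weil_intertwiner r \<alpha> R" "weil_intertwiner r \<beta> R'"
  shows "\<delta> (R * R') = \<delta> R * \<delta> R'"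
proof -
  have c: "R \<in> carrier_mat r r" "R' \<in> carrier_mat r r" using assms weil_intertwinerD by auto
  have "odd_part (R * R') = odd_part R * odd_part R'"
    using assms c weil_intertwiner_preserves_odd by (intro odd_part_mult) auto
  then show ?thesis
    unfolding \<delta>_def using det_mult[OF c] det_mult[OF odd_part_carrier odd_part_carrier, OF c]
    by (simp add: power_mult_distrib)
qed

lemma normalised_intertwiner:
  assumes "\<alpha> \<in> carrier (SL2F r)"
  shows "\<exists>!R. weil_intertwiner r \<alpha> R \<and> \<delta> R = 1"
proof -
  obtain R where R: "weil_intertwiner r \<alpha> R" using weil_intertwiner_exists[OF assms] by blast
  let ?c = "inverse (\<delta> R)"
  have c: "?c \<noteq> 0" using \<delta>_nonzero[OF assms R] by simp
  have "weil_intertwiner r \<alpha> (?c \<cdot>\<^sub>m R)" by (rule weil_intertwiner_smult[OF assms R c])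
  moreover have "\<delta> (?c \<cdot>\<^sub>m R) = 1" using c \<delta>_smult[OF weil_intertwinerD(1)[OF R] c] by simp
  moreover have "R2 = R1"
    if R1: "weil_intertwiner r \<alpha> R1" "\<delta> R1 = 1" and R2: "weil_intertwiner r \<alpha> R2" "\<delta> R2 = 1"
    for R1 R2
  proof -
    obtain c where "c \<noteq> 0" "R2 = c \<cdot>\<^sub>m R1"
      using weil_intertwiner_unique[OF r_odd r_gt_1 assms R1(1) R2(1)] by blast
    then show ?thesis using \<delta>_smult[OF weil_intertwinerD(1)[OF R1(1)], of c] R1 R2 by auto
  qed
  ultimately show ?thesis by blast
qed

text \<open>For any lift \<open>W'\<close> the composite \<open>\<delta> \<circ> W'\<close> is a character of \<open>SL\<^sub>2(\<F>\<^sub>r)\<close>, hence trivial; so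
  \<open>W'\<close> is the normalised lift.\<close>

lemma weil_rep_unique_lift:
  "\<exists>!W. W \<in> hom (SL2F r) (GL r) \<inter> extensional (carrier (SL2F r)) \<and>
     (\<forall>\<alpha> \<in> carrier (SL2F r). weil_intertwiner r \<alpha> (W \<alpha>))"
proof -
  define W where
    "W = (\<lambda>\<alpha> \<in> carrier (SL2F r). THE R. weil_intertwiner r \<alpha> R \<and> \<delta> R = 1)"
  have W: "weil_intertwiner r \<alpha> (W \<alpha>) \<and> \<delta> (W \<alpha>) = 1" if "\<alpha> \<in> carrier (SL2F r)" for \<alpha>
    using theI'[OF normalised_intertwiner[OF that]] that by (simp add: W_def)
  show ?thesis
  proof (rule ex1I[of _ W])
    have "W (\<alpha> \<otimes>\<^bsub>SL2F r\<^esub> \<beta>) = W \<alpha> * W \<beta>"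
      if ab: "\<alpha> \<in> carrier (SL2F r)" "\<beta> \<in> carrier (SL2F r)" for \<alpha> \<beta>
    proof -
      have "weil_intertwiner r (\<alpha> \<otimes>\<^bsub>SL2F r\<^esub> \<beta>) (W \<alpha> * W \<beta>)"
        using W ab by (intro weil_intertwiner_mult r_gt_1 SL2F_closed) auto
      moreover have "\<delta> (W \<alpha> * W \<beta>) = 1" using W ab \<delta>_mult[OF ab] by simp
      ultimately show ?thesis
        using W[OF SL2F_closed[OF ab]] normalised_intertwiner[OF SL2F_closed[OF ab]] by blast
    qed
    then have "W \<in> hom (SL2F r) (GL r)"
      using W by (intro homI) (auto simp: weil_intertwiner_def)
    moreover have "W \<in> extensional (carrier (SL2F r))" by (simp add: W_def)
    ultimately show "W \<in> hom (SL2F r) (GL r) \<inter> extensional (carrier (SL2F r)) \<and>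
        (\<forall>\<alpha> \<in> carrier (SL2F r). weil_intertwiner r \<alpha> (W \<alpha>))"
      using W by blast
  next
    fix W' assume W': "W' \<in> hom (SL2F r) (GL r) \<inter> extensional (carrier (SL2F r)) \<and>
        (\<forall>\<alpha> \<in> carrier (SL2F r). weil_intertwiner r \<alpha> (W' \<alpha>))"
    show "W' = W"
    proof (rule extensionalityI[of _ "carrier (SL2F r)"])
      fix \<alpha> assume \<alpha>: "\<alpha> \<in> carrier (SL2F r)"
      have "(\<delta> \<circ> W') \<alpha> = 1"
      proof (rule SL2F_char_trivial[OF r_prime r_ge_5 _ _ \<alpha>])
        fix \<alpha> \<beta> assume ab: "\<alpha> \<in> carrier (SL2F r)" "\<beta> \<in> carrier (SL2F r)"
        then have "W' (\<alpha> \<otimes>\<^bsub>SL2F r\<^esub> \<beta>) = W' \<alpha> * W' \<beta>" using W' hom_mult by fastforce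
        then show "(\<delta> \<circ> W') (\<alpha> \<otimes>\<^bsub>SL2F r\<^esub> \<beta>) = (\<delta> \<circ> W') \<alpha> * (\<delta> \<circ> W') \<beta>"
          using W' ab \<delta>_mult[OF ab] by simp
      next
        fix \<alpha> assume "\<alpha> \<in> carrier (SL2F r)"
        then show "(\<delta> \<circ> W') \<alpha> \<noteq> 0" using W' \<delta>_nonzero by simp
      qed
      then show "W' \<alpha> = W \<alpha>"
        using W'[THEN conjunct2] W[OF \<alpha>] \<alpha> normalised_intertwiner[OF \<alpha>] by auto
    qed (use W' in \<open>auto simp: W_def\<close>)
  qed
qed

lemma weil_rep_hom: "weil_rep r \<in> hom (SL2F r) (GL r)"
  and weil_rep_intertwiner: "\<alpha> \<in> carrier (SL2F r) \<Longrightarrow> weil_intertwiner r \<alpha> (weil_rep r \<alpha>)"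
  using theI'[OF weil_rep_unique_lift] unfolding weil_rep_def[symmetric] by auto

lemma weil_rep_odd:
  assumes "\<alpha> \<in> carrier (SL2F r)"
  shows "weil_rep r \<alpha> \<in> carrier_mat r r" "det (weil_rep r \<alpha>) \<noteq> 0" "preserves_odd (weil_rep r \<alpha>)"
  using weil_intertwinerD weil_intertwiner_preserves_odd weil_rep_intertwiner assms by blast+

lemma weil_odd_eq: "\<alpha> \<in> carrier (SL2F r) \<Longrightarrow> weil_odd r \<alpha> = odd_part (weil_rep r \<alpha>)"
  unfolding weil_odd_def by (intro restriction_mat_odd weil_rep_odd)

lemma weil_odd_hom: "weil_odd r \<in> hom (SL2F r) (GL n)"
proof (rule homI)
  fix \<alpha> assume \<alpha>: "\<alpha> \<in> carrier (SL2F r)"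
  show "weil_odd r \<alpha> \<in> carrier (GL n)"
    using weil_rep_odd[OF \<alpha>] det_odd_part by (simp add: carrier_GL weil_odd_eq[OF \<alpha>])
next
  fix \<alpha> \<beta> assume ab: "\<alpha> \<in> carrier (SL2F r)" "\<beta> \<in> carrier (SL2F r)"
  have "weil_rep r (\<alpha> \<otimes>\<^bsub>SL2F r\<^esub> \<beta>) = weil_rep r \<alpha> * weil_rep r \<beta>"
    using hom_mult[OF weil_rep_hom ab] by simp
  then show "weil_odd r (\<alpha> \<otimes>\<^bsub>SL2F r\<^esub> \<beta>) = weil_odd r \<alpha> \<otimes>\<^bsub>GL n\<^esub> weil_odd r \<beta>"
    using ab SL2F_closed[OF ab]
    by (simp add: weil_odd_eq odd_part_mult weil_rep_odd)
qed

lemma weil_odd_intertwiner: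
  assumes "\<alpha> \<in> carrier (SL2F r)" "weil_intertwiner r \<alpha> R"
  shows "\<exists>c. c \<noteq> 0 \<and> weil_odd r \<alpha> = c \<cdot>\<^sub>m odd_part R"
  using weil_intertwiner_unique[OF r_odd r_gt_1 assms weil_rep_intertwiner[OF assms(1)]]
    odd_part_smult[OF weil_intertwinerD(1)[OF assms(2)]] by (auto simp: weil_odd_eq[OF assms(1)])

end



section \<open>The quantum representation in the odd basis\<close>

context weil_level
begin

text \<open>As \<open>2 (n + 1) \<equiv> 1\<close> modulo \<open>r\<close>, the number \<open>A\<^sup>2\<close> is the \<open>r\<close>-th root of unity \<open>e(1/2)\<close>.\<close>

lemma so3_A_sq: "(so3_A r)\<^sup>2 = root_e r (int n + 1)"
proof -
  have r: "complex_of_nat r \<noteq> 0" using r_gt_1 by simp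
  have rn: "complex_of_nat r = 2 * of_nat n + 1" by (subst r_eq) simp
  have "2 * of_real pi * \<i> * of_int (int n + 1) = of_real pi * \<i> * of_nat r + of_real pi * \<i>"
    unfolding rn by (simp add: algebra_simps)
  then have "2 * of_real pi * \<i> * of_int (int n + 1) / of_nat r =
      of_real pi * \<i> + 2 * of_real pi * \<i> / (4 * of_nat r) * 2"
    using r by (simp only: add_divide_distrib) simp
  then have "root_e r (int n + 1) = exp (of_real pi * \<i> + 2 * of_real pi * \<i> / (4 * of_nat r) * 2)"
    unfolding root_e_def by (rule arg_cong)
  also have "\<dots> = exp (of_real pi * \<i>) * exp (2 * of_real pi * \<i> / (4 * of_nat r)) ^ 2"
    by (simp only: exp_add mult_2_right power2_eq_square)
  finally show ?thesis by (simp add: so3_A_def power_mult_distrib)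
qed

lemma so3_A_powi: "so3_A r powi (2 * k) = root_e r ((int n + 1) * k)"
proof -
  have "so3_A r powi (2 * k) = root_e r (int n + 1) powi k"
    using so3_A_sq by (simp add: power_int_mult)
  also have "\<dots> = root_e r ((int n + 1) * k)"
    by (cases "k \<ge> 0") (simp_all add: power_int_def root_e_power algebra_simps flip: root_e_minus)
  finally show ?thesis .
qed

text \<open>The denominator \<open>A\<^sup>2 - A\<^sup>-\<^sup>2\<close> of the quantum integers.\<close>

definition den :: complex where "den = root_e r (int n + 1) - root_e r (- (int n + 1))"

lemma qint_eq: "qint r k = (root_e r ((int n + 1) * int k) - root_e r (- ((int n + 1) * int k))) / den"
  using so3_A_powi[of "int k"] so3_A_powi[of "- int k"] so3_A_powi[of 1] so3_A_powi[of "- 1"]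
  by (simp add: qint_def den_def)

lemma den_nonzero: "den \<noteq> 0"
proof
  assume "den = 0"
  then have "[int n + 1 = - (int n + 1)] (mod int r)"
    using r_gt_1 by (simp add: den_def root_e_eq_iff)
  then have "int r dvd int r + 1" by (simp add: cong_iff_dvd_diff r_eq algebra_simps)
  then show False using r_gt_1 by (simp add: dvd_add_right_iff)
qed

text \<open>The quantum integers are real and \<open>[1] = 1\<close>, so the sum of their squares is positive.\<close>

lemma so3_D_nonzero: "so3_D r \<noteq> 0"
proof -
  have cnj: "cnj (root_e r k) = root_e r (- k)" for k
    by (simp add: root_e_cis cis_cnj)
  have real: "of_real (Re (qint r k)) = qint r k" for k
  proof -
    have "cnj (qint r k) = qint r k"
      by (simp add: qint_eq den_def cnj divide_simps) (simp add: algebra_simps)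
    then show ?thesis by (simp add: complex_eq_iff)
  qed
  have fin: "finite (so3_labels r)"
    by (rule finite_subset[of _ "{..r - 3}"]) (auto simp: so3_labels_def)
  have q1: "qint r 1 = 1" using den_nonzero by (simp add: qint_eq den_def)
  have "0 < (\<Sum>i \<in> so3_labels r. (Re (qint r (i + 1)))\<^sup>2)"
    by (rule sum_pos2[OF fin, of 0]) (use q1 in \<open>simp_all add: so3_labels_def\<close>)
  moreover have "(\<Sum>i \<in> so3_labels r. (qint r (i + 1))\<^sup>2) =
      of_real (\<Sum>i \<in> so3_labels r. (Re (qint r (i + 1)))\<^sup>2)"
    unfolding of_real_sum of_real_power real ..
  ultimately show ?thesis unfolding so3_D_def csqrt_eq_0 by (simp only: of_real_eq_0_iff)
qed

text \<open>The label \<open>2 a\<close> corresponds to the basis vector \<open>e\<^sub>k - e\<^sub>-\<^sub>k\<close> with \<open>2 k \<equiv> - (2 a + 1)\<close> modulo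
  \<open>r\<close>, that is \<open>k = n - a\<close>. The change of basis is therefore the order-reversing permutation.\<close>

definition rev_mat :: "complex mat" where
  "rev_mat = mat n n (\<lambda>(a, b). if b = n - 1 - a then 1 else 0)"

lemma rev_mat_carrier [simp]: "rev_mat \<in> carrier_mat n n"
  by (simp add: rev_mat_def)

lemma rev_mat_mult:
  assumes "M \<in> carrier_mat n n" "a < n" "b < n"
  shows "(rev_mat * M) $$ (a, b) = M $$ (n - 1 - a, b)"
proof -
  have "(rev_mat * M) $$ (a, b) = (\<Sum>i = 0..<n. (if i = n - 1 - a then 1 else 0) * M $$ (i, b))"
    using assms by (simp add: rev_mat_def scalar_prod_def)
  then show ?thesis
    using assms by (simp add: if_distrib[of "\<lambda>x. x * _"] sum.delta cong: if_cong)
qed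

lemma mult_rev_mat:
  assumes "M \<in> carrier_mat n n" "a < n" "b < n"
  shows "(M * rev_mat) $$ (a, b) = M $$ (a, n - 1 - b)"
proof -
  have "(M * rev_mat) $$ (a, b) = (\<Sum>i = 0..<n. M $$ (a, i) * (if b = n - 1 - i then 1 else 0))"
    using assms by (simp add: rev_mat_def scalar_prod_def)
  also have "\<dots> = (\<Sum>i = 0..<n. if i = n - 1 - b then M $$ (a, i) else 0)"
    using assms by (intro sum.cong) auto
  finally show ?thesis using assms by (simp add: sum.delta)
qed

lemma rev_mat_conj:
  assumes "M \<in> carrier_mat n n" "a < n" "b < n"
  shows "(rev_mat * M * rev_mat) $$ (a, b) = M $$ (n - 1 - a, n - 1 - b)"
proof -
  have "rev_mat * M \<in> carrier_mat n n" by (rule mult_carrier_mat[OF rev_mat_carrier assms(1)])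
  then show ?thesis using assms by (simp add: mult_rev_mat rev_mat_mult)
qed

lemma rev_mat_square: "rev_mat * rev_mat = 1\<^sub>m n"
proof (intro eq_matI)
  fix a b assume "a < dim_row (1\<^sub>m n)" "b < dim_col (1\<^sub>m n)"
  then have ab: "a < n" "b < n" by auto
  then have "(rev_mat * rev_mat) $$ (a, b) = rev_mat $$ (n - 1 - a, b)"
    by (simp add: rev_mat_mult)
  then show "(rev_mat * rev_mat) $$ (a, b) = 1\<^sub>m n $$ (a, b)"
    using ab by (auto simp: rev_mat_def)
qed (simp_all add: rev_mat_def)

lemma rev_mat_GL: "rev_mat \<in> carrier (GL n)"
proof -
  have "det rev_mat * det rev_mat = 1"
    using det_mult[OF rev_mat_carrier rev_mat_carrier] by (simp add: rev_mat_square)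
  then show ?thesis by (auto simp: carrier_GL)
qed

lemma odd_part_index:
  assumes "M \<in> carrier_mat r r" "a < n" "b < n"
  shows "odd_part M $$ (a, b) = M $$ (a + 1, b + 1) - M $$ (a + 1, r - 1 - b)"
proof -
  have "M * B \<in> carrier_mat r n" using assms(1) by simp
  then have "odd_part M $$ (a, b) = (M * B) $$ (a + 1, b)"
    unfolding odd_part_def using assms(2,3) by (rule C_mult)
  moreover have "a + 1 < r" using assms(2) r_eq by simp
  ultimately show ?thesis using mult_B[OF assms(1) _ assms(3)] by simp
qed

text \<open>Twice the \<open>(k, l)\<close> exponent of the odd Fourier matrix is \<open>(2 k) (2 l) \<equiv> (2 a + 1) (2 b + 1)\<close> for
  \<open>k = n - a\<close>, \<open>l = n - b\<close>: the signs of the two correspondences cancel.\<close>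

lemma so3_S_eq: "so3_S r = (1 / (so3_D r * den)) \<cdot>\<^sub>m (rev_mat * odd_part weil_S * rev_mat)"
proof (intro eq_matI)
  let ?R = "(1 / (so3_D r * den)) \<cdot>\<^sub>m (rev_mat * odd_part weil_S * rev_mat)"
  have c: "odd_part weil_S \<in> carrier_mat n n" by simp
  fix a b assume "a < dim_row ?R" "b < dim_col ?R"
  then have ab: "a < n" "b < n" by (auto simp: rev_mat_def)
  let ?k = "n - a" and ?l = "n - b"
  have kl: "n - 1 - a + 1 = ?k" "n - 1 - b + 1 = ?l" "r - 1 - (n - 1 - b) = r - ?l"
    and bounds: "?k < r" "?l < r" "r - ?l < r" and idx: "n - 1 - a < n" "n - 1 - b < n"
    using ab r_eq by auto
  have neg: "[2 * int ?k * int (r - ?l) = - (2 * int ?k * int ?l)] (mod int r)"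
    using bounds by (simp add: cong_iff_dvd_diff of_nat_diff algebra_simps)
  have key: "[2 * int ?k * int ?l = (int n + 1) * int ((2 * a + 1) * (2 * b + 1))] (mod int r)"
  proof -
    have R: "int r = 2 * int n + 1" by (simp add: r_eq)
    have K: "int a = int n - int ?k" "int b = int n - int ?l" using ab by auto
    have "2 * int ?k * int ?l - (int n + 1) * int ((2 * a + 1) * (2 * b + 1)) =
       int r * (- (int n + 1) * (int r - 2 * int ?k - 2 * int ?l) - 2 * int ?k * int ?l)"
      unfolding R of_nat_mult of_nat_add K by (simp add: algebra_simps)
    then show ?thesis unfolding cong_iff_dvd_diff by simp
  qed
  have "odd_part weil_S $$ (n - 1 - a, n - 1 - b) =
      root_e r (2 * int ?k * int ?l) - root_e r (2 * int ?k * int (r - ?l))"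
    using bounds by (simp only: odd_part_index[OF weil_S_carrier idx] kl) (simp add: weil_S_def)
  also have "root_e r (2 * int ?k * int (r - ?l)) = root_e r (- (2 * int ?k * int ?l))"
    using neg r_gt_1 by (simp add: root_e_eq_iff)
  also have "\<dots> = root_e r (- ((int n + 1) * int ((2 * a + 1) * (2 * b + 1))))"
    using key r_gt_1 by (simp only: root_e_minus) (simp add: root_e_eq_iff)
  also have "root_e r (2 * int ?k * int ?l) = root_e r ((int n + 1) * int ((2 * a + 1) * (2 * b + 1)))"
    using key r_gt_1 by (simp only: root_e_eq_iff)
  finally have "odd_part weil_S $$ (n - 1 - a, n - 1 - b) = den * qint r ((2 * a + 1) * (2 * b + 1))"
    using den_nonzero by (simp add: qint_eq)
  moreover have "so3_S r $$ (a, b) = 1 / so3_D r * qint r ((2 * a + 1) * (2 * b + 1))"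
    using ab unfolding so3_S_def n_eq[symmetric] by (simp add: Let_def)
  moreover have "?R $$ (a, b) = 1 / (so3_D r * den) * odd_part weil_S $$ (n - 1 - a, n - 1 - b)"
    using ab rev_mat_conj[OF c ab] carrier_matD[OF rev_mat_carrier] by simp
  ultimately show "so3_S r $$ (a, b) = ?R $$ (a, b)"
    using den_nonzero by simp
qed (use carrier_matD[OF rev_mat_carrier] n_eq[symmetric] in \<open>simp_all add: so3_S_def\<close>)

text \<open>At the label \<open>j = 2 a\<close> the power of \<open>A\<close> with exponent \<open>- j (j + 2)\<close> is \<open>e(- a (a + 1))\<close>, and
  completing the square gives \<open>a (a + 1) \<equiv> (n - a)\<^sup>2 - n\<^sup>2\<close>.\<close>

lemma so3_T_eq: "so3_T r = root_e r (int n * int n) \<cdot>\<^sub>m (rev_mat * odd_part weil_T * rev_mat)"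
proof (intro eq_matI)
  let ?R = "root_e r (int n * int n) \<cdot>\<^sub>m (rev_mat * odd_part weil_T * rev_mat)"
  have c: "odd_part weil_T \<in> carrier_mat n n" by simp
  fix a b assume "a < dim_row ?R" "b < dim_col ?R"
  then have ab: "a < n" "b < n" by (auto simp: rev_mat_def)
  let ?k = "n - a" and ?l = "n - b"
  have kl: "n - 1 - a + 1 = ?k" "n - 1 - b + 1 = ?l" "r - 1 - (n - 1 - b) = r - ?l"
    and bounds: "?k < r" "?l < r" "r - ?l < r" "?k \<noteq> r - ?l" "?k = ?l \<longleftrightarrow> a = b"
    and idx: "n - 1 - a < n" "n - 1 - b < n"
    using ab r_eq by auto
  have "odd_part weil_T $$ (n - 1 - a, n - 1 - b) = (if a = b then root_e r (- (int ?k * int ?k)) else 0)"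
    using bounds by (simp only: odd_part_index[OF weil_T_carrier idx] kl) (simp add: weil_T_def)
  moreover have "so3_A r powi (- int (2 * a * (2 * a + 2))) =
      root_e r (int n * int n) * root_e r (- (int ?k * int ?k))"
  proof -
    have R: "int r = 2 * int n + 1" by (simp add: r_eq)
    have K: "int a = int n - int ?k" using ab by auto
    have "so3_A r powi (- int (2 * a * (2 * a + 2))) =
        root_e r ((int n + 1) * (- (2 * int a * (int a + 1))))"
      unfolding so3_A_powi[symmetric] by (rule arg_cong[of _ _ "(powi) (so3_A r)"]) (simp add: algebra_simps)
    also have "\<dots> = root_e r (int n * int n + - (int ?k * int ?k))"
    proof -
      have "(int n + 1) * (- (2 * int a * (int a + 1))) - (int n * int n + - (int ?k * int ?k)) =
          int r * (- (int a * (int a + 1)) - int a)"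
        unfolding R using K by (simp add: algebra_simps)
      then show ?thesis using r_gt_1 by (simp add: root_e_eq_iff cong_iff_dvd_diff)
    qed
    finally show ?thesis by (simp only: root_e_add)
  qed
  moreover have "so3_T r $$ (a, b) = (if a = b then so3_A r powi (- int (2 * a * (2 * a + 2))) else 0)"
    using ab unfolding so3_T_def n_eq[symmetric] by (auto simp: Let_def)
  moreover have "?R $$ (a, b) = root_e r (int n * int n) * odd_part weil_T $$ (n - 1 - a, n - 1 - b)"
    using ab rev_mat_conj[OF c ab] carrier_matD[OF rev_mat_carrier] by simp
  ultimately show "so3_T r $$ (a, b) = ?R $$ (a, b)" by (cases "a = b") simp_all
qed (use carrier_matD[OF rev_mat_carrier] n_eq[symmetric] in \<open>simp_all add: so3_T_def\<close>)

text \<open>The odd factor of the Weil representation as a projective representation of \<open>SL\<^sub>2(\<int>)\<close>.\<close>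

definition odd_proj :: "int \<times> int \<times> int \<times> int \<Rightarrow> complex mat set" where
  "odd_proj = proj_class n \<circ> weil_odd r \<circ> SL2_reduce r"

lemma odd_proj_hom: "odd_proj \<in> hom SL2Z (PGL n)"
  unfolding odd_proj_def
  by (intro hom_compose[OF SL2_reduce_hom[OF r_gt_1]] hom_compose[OF weil_odd_hom] proj_class_hom)

lemma odd_proj_eq:
  assumes "g \<in> carrier SL2Z" "weil_intertwiner r (SL2_reduce r g) R"
  shows "odd_proj g = proj_class n (odd_part R)"
proof -
  obtain c where "c \<noteq> 0" "weil_odd r (SL2_reduce r g) = c \<cdot>\<^sub>m odd_part R"
    using weil_odd_intertwiner[OF reduce_carrier[OF assms(1)] assms(2)] by blast
  then show ?thesis
    using proj_class_smult[OF odd_part_carrier] weil_intertwinerD(1)[OF assms(2)]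
    by (simp add: odd_proj_def)
qed

abbreviation rev_class :: "complex mat set" where "rev_class \<equiv> proj_class n rev_mat"

lemma rev_class_carrier: "rev_class \<in> carrier (PGL n)"
  by (rule hom_in_carrier[OF proj_class_hom rev_mat_GL])

lemma rev_class_square: "rev_class \<otimes>\<^bsub>PGL n\<^esub> rev_class = \<one>\<^bsub>PGL n\<^esub>"
proof -
  have "rev_class \<otimes>\<^bsub>PGL n\<^esub> rev_class = proj_class n (1\<^sub>m n)"
    using hom_mult[OF proj_class_hom rev_mat_GL rev_mat_GL] by (simp add: rev_mat_square)
  then show ?thesis using hom_one[OF proj_class_hom GL_group PGL_group] by simp
qed

lemma rev_class_conj:
  assumes "M \<in> carrier (GL n)" "c \<noteq> 0"
  shows "proj_class n (c \<cdot>\<^sub>m (rev_mat * M * rev_mat)) = rev_class \<otimes>\<^bsub>PGL n\<^esub> proj_class n M \<otimes>\<^bsub>PGL n\<^esub> rev_class"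
proof -
  interpret group "GL n" by (rule GL_group)
  have RM: "rev_mat * M \<in> carrier (GL n)" "rev_mat * M * rev_mat \<in> carrier (GL n)"
    using m_closed[OF rev_mat_GL assms(1)] m_closed[OF m_closed[OF rev_mat_GL assms(1)] rev_mat_GL]
    by simp_all
  have "proj_class n (c \<cdot>\<^sub>m (rev_mat * M * rev_mat)) = proj_class n (rev_mat * M * rev_mat)"
    using RM(2) assms(2) by (intro proj_class_smult) (simp_all add: carrier_GL)
  then show ?thesis
    using hom_mult[OF proj_class_hom RM(1) rev_mat_GL] hom_mult[OF proj_class_hom rev_mat_GL assms(1)]
    by simp
qed

text \<open>The conjugate of \<open>odd_proj\<close> by the order-reversing permutation, which is its own inverse. On
  \<open>s\<close> and \<open>t\<close> it takes the values prescribed for the \<open>SO(3)\<close>-theory, so it is the representation of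
  that theory.\<close>

definition conj_proj :: "int \<times> int \<times> int \<times> int \<Rightarrow> complex mat set" where
  "conj_proj = (\<lambda>g \<in> carrier SL2Z. rev_class \<otimes>\<^bsub>PGL n\<^esub> odd_proj g \<otimes>\<^bsub>PGL n\<^esub> rev_class)"

lemma conj_proj_hom: "conj_proj \<in> hom SL2Z (PGL n)"
proof -
  interpret group "PGL n" by (rule PGL_group)
  note [simp] = rev_class_carrier hom_in_carrier[OF odd_proj_hom]
  show ?thesis
  proof (rule homI)
    fix g h assume gh: "g \<in> carrier SL2Z" "h \<in> carrier SL2Z"
    let ?p = rev_class and ?x = "odd_proj g" and ?y = "odd_proj h"
    have "?p \<otimes>\<^bsub>PGL n\<^esub> ?x \<otimes>\<^bsub>PGL n\<^esub> ?p \<otimes>\<^bsub>PGL n\<^esub> (?p \<otimes>\<^bsub>PGL n\<^esub> ?y \<otimes>\<^bsub>PGL n\<^esub> ?p)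
      = ?p \<otimes>\<^bsub>PGL n\<^esub> ?x \<otimes>\<^bsub>PGL n\<^esub> (?p \<otimes>\<^bsub>PGL n\<^esub> ?p) \<otimes>\<^bsub>PGL n\<^esub> ?y \<otimes>\<^bsub>PGL n\<^esub> ?p"
      using gh by (simp add: m_assoc)
    also have "\<dots> = ?p \<otimes>\<^bsub>PGL n\<^esub> (?x \<otimes>\<^bsub>PGL n\<^esub> ?y) \<otimes>\<^bsub>PGL n\<^esub> ?p"
      using gh by (simp add: rev_class_square m_assoc)
    finally show "conj_proj (g \<otimes>\<^bsub>SL2Z\<^esub> h) = conj_proj g \<otimes>\<^bsub>PGL n\<^esub> conj_proj h"
      using gh SL2Z_closed[OF gh] hom_mult[OF odd_proj_hom gh] by (simp add: conj_proj_def)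
  qed (simp add: conj_proj_def)
qed

lemma odd_part_GL:
  assumes "g \<in> carrier SL2Z" "weil_intertwiner r (SL2_reduce r g) R"
  shows "odd_part R \<in> carrier (GL n)"
  using det_odd_part weil_intertwinerD[OF assms(2)]
    weil_intertwiner_preserves_odd[OF reduce_carrier[OF assms(1)] assms(2)] by (simp add: carrier_GL)

lemma so3_rep_eq: "so3_rep r = conj_proj"
  unfolding so3_rep_def n_eq[symmetric]
proof (rule the_equality)
  have "1 / (so3_D r * den) \<noteq> 0" using so3_D_nonzero den_nonzero by simp
  then have s: "conj_proj SL2_s = proj_class n (so3_S r)"
    unfolding so3_S_eq
    by (subst rev_class_conj[OF odd_part_GL[OF SL2_s_carrier weil_intertwiner_S]])
       (simp_all add: conj_proj_def SL2_s_carrier odd_proj_eq[OF SL2_s_carrier weil_intertwiner_S])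
  have t: "conj_proj SL2_t = proj_class n (so3_T r)"
    unfolding so3_T_eq
    by (subst rev_class_conj[OF odd_part_GL[OF SL2_t_carrier weil_intertwiner_T]])
       (simp_all add: conj_proj_def SL2_t_carrier odd_proj_eq[OF SL2_t_carrier weil_intertwiner_T])
  show "conj_proj \<in> hom SL2Z (PGL n) \<inter> extensional (carrier SL2Z) \<and>
     conj_proj SL2_s = proj_class n (so3_S r) \<and> conj_proj SL2_t = proj_class n (so3_T r)"
    using s t conj_proj_hom by (simp add: conj_proj_def)
  fix \<phi> assume \<phi>: "\<phi> \<in> hom SL2Z (PGL n) \<inter> extensional (carrier SL2Z) \<and>
     \<phi> SL2_s = proj_class n (so3_S r) \<and> \<phi> SL2_t = proj_class n (so3_T r)"
  then have \<phi>_hom: "\<phi> \<in> hom SL2Z (PGL n)" by blast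
  show "\<phi> = conj_proj"
  proof (rule extensionalityI[of _ "carrier SL2Z"])
    fix g assume "g \<in> carrier SL2Z"
    then show "\<phi> g = conj_proj g"
    proof (induction rule: SL2Z_induct)
      case (mult g h)
      then show ?case using hom_mult[OF \<phi>_hom] hom_mult[OF conj_proj_hom] by simp
    qed (use \<phi> s t in simp_all)
  qed (use \<phi> in \<open>auto simp: conj_proj_def\<close>)
qed

lemma so3_equiv_weil_odd: "proj_rep_equiv SL2Z n (so3_rep r) (proj_class n \<circ> weil_odd r \<circ> SL2_reduce r)"
  unfolding proj_rep_equiv_def odd_proj_def[symmetric] so3_rep_eq
proof (intro conjI bexI ballI)
  interpret group "PGL n" by (rule PGL_group)
  note [simp] = rev_class_carrier hom_in_carrier[OF odd_proj_hom]
  have inv: "inv\<^bsub>PGL n\<^esub> rev_class = rev_class"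
    by (rule inv_equality) (simp_all add: rev_class_square)
  fix g assume g: "g \<in> carrier SL2Z"
  let ?p = rev_class and ?x = "odd_proj g"
  have "?p \<otimes>\<^bsub>PGL n\<^esub> conj_proj g \<otimes>\<^bsub>PGL n\<^esub> ?p =
      (?p \<otimes>\<^bsub>PGL n\<^esub> ?p) \<otimes>\<^bsub>PGL n\<^esub> ?x \<otimes>\<^bsub>PGL n\<^esub> (?p \<otimes>\<^bsub>PGL n\<^esub> ?p)"
    using g by (simp add: conj_proj_def m_assoc)
  then show "?p \<otimes>\<^bsub>PGL n\<^esub> conj_proj g \<otimes>\<^bsub>PGL n\<^esub> inv\<^bsub>PGL n\<^esub> ?p = ?x"
    using g by (simp add: inv rev_class_square)
qed (rule conj_proj_hom odd_proj_hom rev_class_carrier)+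

end

theorem theorem1:
  fixes r :: nat
  assumes "prime r" and "r \<ge> 5"
  shows "proj_rep_equiv SL2Z ((r - 1) div 2)
           (so3_rep r)
           (proj_class ((r - 1) div 2) \<circ> weil_odd r \<circ> SL2_reduce r)"
proof -
  interpret weil_level r "(r - 1) div 2" using assms by unfold_locales auto
  show ?thesis by (rule so3_equiv_weil_odd)
qed

end
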